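(* Let $\alpha$, $\beta$, $\gamma$ be partitions of the same size and let $A\in\mathsf{M}(\alpha,\beta)_\gamma$ be an additive matrix. Then $\langle\phi^{n\alpha}\otimes\phi^{n\beta},\chi^{n\gamma}\rangle=1$ for all $n\in\mathbb{N}$.
   Context: $\mathbb{N}$ is the set of positive integers. A partition is a weakly decreasing sequence of positive integers; its size is the sum of its parts and its length is the number of its parts. $n\alpha$ is the partition $\alpha$ with every part multiplied by $n$. For a partition $\lambda$ of $m$, $\chi^\lambda$ is the irreducible complex character of the symmetric group $S_m$ associated to $\lambda$, and $\phi^\lambda=\mathrm{Ind}_{S_\lambda}^{S_m}(1_\lambda)$ is the permutation character induced from the trivial character of the Young subgroup $S_\lambda=S_{\lambda_1}\times S_{\lambda_2}\times\cdots$. $\langle\cdot,\cdot\rangle$ is the usual scalar product of complex characters. For partitions $\alpha$ (of length $p$) and $\beta$ (of length $q$) of the same size, $\mathsf{M}(\alpha,\beta)$ is the set of $p\times q$ matrices with nonnegative integer entries, row-sum vector $\alpha$ and column-sum vector $\beta$. For such a matrix $A$, $\pi(A)$ denotes the sequence of entries of $A$ arranged in weakly decreasing order, regarded as a partition (trailing zeros are disregarded), and $\mathsf{M}(\alpha,\beta)_\gamma$ is the set of $A\in\mathsf{M}(\alpha,\beta)$ with $\pi(A)=\gamma$. A $p\times q$ matrix $A=(a_{i,j})$ with nonnegative integer entries is called additive if there exist real numbers $x_1,\dots,x_p,y_1,\dots,y_q$ such that $a_{i,j}>a_{k,l}$ implies $x_i+y_j>x_k+y_l$, for all $i,k\in\{1,\dots,p\}$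 and all $j,l\in\{1,\dots,q\}$. *)

theory Defs
  imports
    Complex_Main
    "HOL-Algebra.Sym_Groups"
    "HOL-Combinatorics.Permutations"
    "HOL-Library.Function_Algebras"
    "Jordan_Normal_Form.Matrix"
begin

section \<open>Class functions on a finite group\<close>

definition char_inner :: "('g, 'r) monoid_scheme \<Rightarrow> ('g \<Rightarrow> complex) \<Rightarrow> ('g \<Rightarrow> complex) \<Rightarrow> complex"
  where "char_inner G f h =
    (1 / of_nat (card (carrier G))) * (\<Sum>g\<in>carrier G. f g * cnj (h g))"

text \<open>The character of the (inner) tensor product of two representations is the pointwise product.\<close>

definition char_tensor :: "('g \<Rightarrow> complex) \<Rightarrow> ('g \<Rightarrow> complex) \<Rightarrow> 'g \<Rightarrow> complex"
  where "char_tensor f h = (\<lambda>g. f g * h g)"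

text \<open>Frobenius' formula for the class function of \<open>G\<close> induced from a class function \<open>\<psi>\<close>
  of a subgroup \<open>H\<close>.\<close>

definition induced_char ::
  "('g, 'r) monoid_scheme \<Rightarrow> 'g set \<Rightarrow> ('g \<Rightarrow> complex) \<Rightarrow> 'g \<Rightarrow> complex"
  where "induced_char G H \<psi> g =
    (1 / of_nat (card H)) *
    (\<Sum>x\<in>carrier G.
       if inv\<^bsub>G\<^esub> x \<otimes>\<^bsub>G\<^esub> g \<otimes>\<^bsub>G\<^esub> x \<in> H then \<psi> (inv\<^bsub>G\<^esub> x \<otimes>\<^bsub>G\<^esub> g \<otimes>\<^bsub>G\<^esub> x) else 0)"

section \<open>Group algebra and traces\<close>

definition fun_scale :: "complex \<Rightarrow> ('g \<Rightarrow> complex) \<Rightarrow> 'g \<Rightarrow> complex"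
  where "fun_scale c f = (\<lambda>x. c * f x)"

global_interpretation cfun: vector_space "fun_scale :: complex \<Rightarrow> ('g \<Rightarrow> complex) \<Rightarrow> 'g \<Rightarrow> complex"
  by unfold_locales (auto simp: fun_scale_def fun_eq_iff algebra_simps)

text \<open>Trace of a linear endomorphism \<open>T\<close> of a finite-dimensional space \<open>V\<close> of complex functions:
  the sum of the diagonal entries of the matrix of \<open>T\<close> in a basis of \<open>V\<close>. It does not depend on
  the basis, so an arbitrary one is chosen.\<close>

definition trace_on :: "('g \<Rightarrow> complex) set \<Rightarrow> (('g \<Rightarrow> complex) \<Rightarrow> 'g \<Rightarrow> complex) \<Rightarrow> complex"
  where "trace_on V T =
    (let B = (SOME B. cfun.independent B \<and> cfun.span B = V)
     in \<Sum>b\<in>B. cfun.representation B (T b) b)"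

text \<open>The element \<open>\<Sum>g. f g \<cdot> g\<close> of the complex group algebra of \<open>G\<close> is represented by its coefficient
  function \<open>f\<close>, which is zero outside \<open>carrier G\<close>.\<close>

definition group_algebra :: "('g, 'r) monoid_scheme \<Rightarrow> ('g \<Rightarrow> complex) set"
  where "group_algebra G = {f. \<forall>x. x \<notin> carrier G \<longrightarrow> f x = 0}"

definition ga_elem :: "'g \<Rightarrow> 'g \<Rightarrow> complex"
  where "ga_elem g = (\<lambda>x. if x = g then 1 else 0)"

definition ga_mult ::
  "('g, 'r) monoid_scheme \<Rightarrow> ('g \<Rightarrow> complex) \<Rightarrow> ('g \<Rightarrow> complex) \<Rightarrow> 'g \<Rightarrow> complex"
  where "ga_mult G f h = (\<lambda>x. if x \<in> carrier G
     then \<Sum>y\<in>carrier G. f y * h (inv\<^bsub>G\<^esub> y \<otimes>\<^bsub>G\<^esub> x) else 0)"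

text \<open>Character of the left ideal \<open>V\<close> of the group algebra, on which \<open>g\<close> acts by left
  multiplication.\<close>

definition left_ideal_char ::
  "('g, 'r) monoid_scheme \<Rightarrow> ('g \<Rightarrow> complex) set \<Rightarrow> 'g \<Rightarrow> complex"
  where "left_ideal_char G V g = trace_on V (ga_mult G (ga_elem g))"

section \<open>Partitions and characters of symmetric groups\<close>

definition is_partition :: "nat list \<Rightarrow> bool"
  where "is_partition \<mu> \<longleftrightarrow> sorted_wrt (\<ge>) \<mu> \<and> (\<forall>k\<in>set \<mu>. 0 < k)"

definition scale_partition :: "nat \<Rightarrow> nat list \<Rightarrow> nat list"
  where "scale_partition n \<mu> = map (\<lambda>k. n * k) \<mu>"

text \<open>The cells \<open>(i, j)\<close> with \<open>i < length \<mu>\<close> and \<open>j < \<mu> ! i\<close> are numbered from 1 to the size of \<open>\<mu>\<close>,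
  row by row.\<close>

definition canon_tableau :: "nat list \<Rightarrow> nat \<Rightarrow> nat \<Rightarrow> nat"
  where "canon_tableau \<mu> i j = sum_list (take i \<mu>) + j + 1"

definition tableau_row :: "nat list \<Rightarrow> nat \<Rightarrow> nat set"
  where "tableau_row \<mu> i = {canon_tableau \<mu> i j | j. j < \<mu> ! i}"

definition tableau_col :: "nat list \<Rightarrow> nat \<Rightarrow> nat set"
  where "tableau_col \<mu> j = {canon_tableau \<mu> i j | i. i < length \<mu> \<and> j < \<mu> ! i}"

text \<open>The Young subgroup \<open>S_\<mu>\<close> permutes separately the consecutive blocks of sizes
  \<open>\<mu> ! 0, \<mu> ! 1, \<dots>\<close>, which are the rows of the canonical tableau.\<close>

definition young_subgroup :: "nat list \<Rightarrow> (nat \<Rightarrow> nat) set"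
  where "young_subgroup \<mu> =
    {p \<in> carrier (sym_group (sum_list \<mu>)). \<forall>i<length \<mu>. p ` tableau_row \<mu> i = tableau_row \<mu> i}"

definition column_subgroup :: "nat list \<Rightarrow> (nat \<Rightarrow> nat) set"
  where "column_subgroup \<mu> =
    {p \<in> carrier (sym_group (sum_list \<mu>)). \<forall>j. p ` tableau_col \<mu> j = tableau_col \<mu> j}"

definition perm_char :: "nat list \<Rightarrow> (nat \<Rightarrow> nat) \<Rightarrow> complex"
  where "perm_char \<mu> = induced_char (sym_group (sum_list \<mu>)) (young_subgroup \<mu>) (\<lambda>_. 1)"

text \<open>The irreducible character attached to \<open>\<mu>\<close> is the character of the Specht module, realised
  as the left ideal \<open>\<complex>[S_m] c_\<mu>\<close> generated by the Young symmetrizer \<open>c_\<mu> = a_\<mu> b_\<mu>\<close>, where \<open>a_\<mu>\<close> is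
  the sum over the row group and \<open>b_\<mu>\<close> the signed sum over the column group of the canonical
  tableau. With this convention the one-row partition gives the trivial character and the
  one-column partition gives the sign character.\<close>

definition row_symmetrizer :: "nat list \<Rightarrow> (nat \<Rightarrow> nat) \<Rightarrow> complex"
  where "row_symmetrizer \<mu> = (\<lambda>p. if p \<in> young_subgroup \<mu> then 1 else 0)"

definition column_antisymmetrizer :: "nat list \<Rightarrow> (nat \<Rightarrow> nat) \<Rightarrow> complex"
  where "column_antisymmetrizer \<mu> = (\<lambda>p. if p \<in> column_subgroup \<mu> then of_int (sign p) else 0)"

definition young_symmetrizer :: "nat list \<Rightarrow> (nat \<Rightarrow> nat) \<Rightarrow> complex"
  where "young_symmetrizer \<mu> =
    ga_mult (sym_group (sum_list \<mu>)) (row_symmetrizer \<mu>) (column_antisymmetrizer \<mu>)"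

definition specht_module :: "nat list \<Rightarrow> ((nat \<Rightarrow> nat) \<Rightarrow> complex) set"
  where "specht_module \<mu> =
    (let G = sym_group (sum_list \<mu>) in (\<lambda>f. ga_mult G f (young_symmetrizer \<mu>)) ` group_algebra G)"

definition irr_char :: "nat list \<Rightarrow> (nat \<Rightarrow> nat) \<Rightarrow> complex"
  where "irr_char \<mu> = left_ideal_char (sym_group (sum_list \<mu>)) (specht_module \<mu>)"

section \<open>Matrices with prescribed margins\<close>

text \<open>Rows and columns are indexed from 0.\<close>

definition margin_matrices :: "nat list \<Rightarrow> nat list \<Rightarrow> nat mat set"
  where "margin_matrices \<alpha> \<beta> =
    {A \<in> carrier_mat (length \<alpha>) (length \<beta>).
       (\<forall>i<length \<alpha>. (\<Sum>j<length \<beta>. A $$ (i, j)) = \<alpha> ! i) \<and>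
       (\<forall>j<length \<beta>. (\<Sum>i<length \<alpha>. A $$ (i, j)) = \<beta> ! j)}"

definition entry_list :: "nat mat \<Rightarrow> nat list"
  where "entry_list A = [A $$ (i, j). i \<leftarrow> [0..<dim_row A], j \<leftarrow> [0..<dim_col A]]"

definition pi_seq :: "nat mat \<Rightarrow> nat list"
  where "pi_seq A = rev (sort (filter (\<lambda>a. a \<noteq> 0) (entry_list A)))"

definition margin_matrices_pi :: "nat list \<Rightarrow> nat list \<Rightarrow> nat list \<Rightarrow> nat mat set"
  where "margin_matrices_pi \<alpha> \<beta> \<gamma> = {A \<in> margin_matrices \<alpha> \<beta>. pi_seq A = \<gamma>}"

definition additive_matrix :: "nat mat \<Rightarrow> bool"
  where "additive_matrix A \<longleftrightarrow>
    (\<exists>x y :: nat \<Rightarrow> real.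
       \<forall>i<dim_row A. \<forall>k<dim_row A. \<forall>j<dim_col A. \<forall>l<dim_col A.
         A $$ (i, j) > A $$ (k, l) \<longrightarrow> x i + y j > x k + y l)"

end

theory Submission
  imports Defs
begin

text \<open>
  The matrix \<open>n A\<close> is additive whenever \<open>A\<close> is, so it suffices to treat \<open>n = 1\<close>. Let \<open>c\<close> be the Young
  symmetrizer of \<open>\<gamma>\<close>, the sum of \<open>sign q\<close> times \<open>p \<circ> q\<close> over row permutations \<open>p\<close> and column
  permutations \<open>q\<close>, and let \<open>f\<close> be the product of the two permutation characters.

  By von Neumann's lemma \<open>c\<^sup>2 = k c\<close>, and \<open>k \<noteq> 0\<close> by a positivity argument
  (\<open>young_symmetrizer_quasi_idempotent\<close>, \<open>young_symmetrizer_scalar_nonzero\<close>). Hence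
  \<open>c / k\<close> is an idempotent, traces on the left ideal of \<open>c\<close> can be taken on the whole group algebra, and
  the multiplicity of the irreducible character in \<open>f\<close> becomes
  \<open>(1 / k) * (\<Sum>g. f g * c g)\<close> (\<open>char_inner_left_ideal\<close>). It remains to see that the
  sum equals \<open>k\<close>, the coefficient of the identity in \<open>c\<^sup>2\<close>.

  The number \<open>f g\<close> counts the words \<open>w\<close> on the points \<open>1, \<dots>, m\<close>, with positions \<open>(i, j)\<close> of a matrix
  as letters, whose numbers of letters in each row and column are the parts of \<open>\<alpha>\<close> and \<open>\<beta>\<close> and which are fixed by \<open>g\<close>
  (\<open>perm_char_eq_card_fixed\<close>). In \<open>\<Sum>g. f g * c g\<close> the alternating sum over the column group removes every word with
  a repeated letter in some column of the tableau of \<open>\<gamma>\<close> (\<open>sum_sign_cancels\<close>).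

  The decisive point is that additivity leaves only one class of words. Give the letter \<open>(i, j)\<close> the
  weight \<open>x i + y j\<close>; the total weight of a word depends only on \<open>\<alpha>\<close> and \<open>\<beta>\<close>. Let \<open>u0\<close> be
  the word whose rows are constant, the row of length \<open>\<gamma> ! s\<close> carrying a position of \<open>A\<close> with that
  entry. Its column \<open>j\<close> carries the positions with entry greater than \<open>j\<close>, which are strictly
  heavier than all the others. A word with distinct letters in every column therefore weighs at most
  as much as \<open>u0\<close> in each column, and as the total weights agree, it has the same letters as \<open>u0\<close> in each column
  (\<open>column_rearrangement\<close>). So the surviving words are \<open>u0 \<circ> q\<close> for column permutations \<open>q\<close>, and
  their contribution is the expansion of the identity coefficient of \<open>c\<^sup>2\<close>
  (\<open>sum_fixed_words_young_symmetrizer\<close>). The exchange argument also proves von Neumann's lemma, with the rows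
  of the tableau as letters and their lengths as weights.
\<close>

(* keeps the interval {1..n} of permuted points in one syntactic form *)
declare One_nat_def [simp del]

section \<open>Summation over a finite group\<close>

lemma (in group) inv_mult_cancel:
  assumes "x \<in> carrier G" "y \<in> carrier G"
  shows "inv x \<otimes> (x \<otimes> y) = y" "x \<otimes> (inv x \<otimes> y) = y"
  using assms by (simp_all add: m_assoc[symmetric])

lemma (in group) sum_translate_left:
  assumes "g \<in> carrier G"
  shows "(\<Sum>y\<in>carrier G. F (g \<otimes> y)) = (\<Sum>y\<in>carrier G. F y)"
  by (rule sum.reindex_bij_witness[where i = "\<lambda>y. inv g \<otimes> y" and j = "\<lambda>y. g \<otimes> y"])
    (use assms in \<open>auto simp: m_assoc[symmetric]\<close>)

lemma (in group) sum_translate_right: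
  assumes "g \<in> carrier G"
  shows "(\<Sum>y\<in>carrier G. F (y \<otimes> g)) = (\<Sum>y\<in>carrier G. F y)"
  by (rule sum.reindex_bij_witness[where i = "\<lambda>y. y \<otimes> inv g" and j = "\<lambda>y. y \<otimes> g"])
    (use assms in \<open>auto simp: m_assoc\<close>)

lemma (in group) sum_inverse:
  "(\<Sum>y\<in>carrier G. F (inv y)) = (\<Sum>y\<in>carrier G. F y)"
  by (rule sum.reindex_bij_witness[where i = "\<lambda>y. inv y" and j = "\<lambda>y. inv y"]) auto

lemma (in group) sum_subgroup_translate_left:
  assumes "subgroup H G" "g \<in> H"
  shows "(\<Sum>y\<in>H. F (g \<otimes> y)) = (\<Sum>y\<in>H. F y)"
proof -
  interpret H: group "G\<lparr>carrier := H\<rparr>"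
    using assms(1) by (rule subgroup_imp_group)
  show ?thesis
    using H.sum_translate_left[of g F] assms(2) by simp
qed

lemma (in group) sum_subgroup_inverse:
  assumes "subgroup H G"
  shows "(\<Sum>y\<in>H. F (inv y)) = (\<Sum>y\<in>H. F y)"
  by (rule sum.reindex_bij_witness[where i = "\<lambda>y. inv y" and j = "\<lambda>y. inv y"])
    (use assms in \<open>auto simp: subgroup.m_inv_closed subgroup.mem_carrier\<close>)

section \<open>The group algebra\<close>

lemma sum_fun_eval: "(\<Sum>i\<in>I. F i) x = (\<Sum>i\<in>I. F i x)" for F :: "'i \<Rightarrow> 'g \<Rightarrow> complex"
  by (induction I rule: infinite_finite_induct) auto

lemma ga_mult_outside: "x \<notin> carrier G \<Longrightarrow> ga_mult G f h x = 0"
  by (simp add: ga_mult_def)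

lemma ga_mult_in_group_algebra: "ga_mult G f h \<in> group_algebra G"
  by (simp add: group_algebra_def ga_mult_outside)

text \<open>The linear extension of \<open>F\<close> to the group algebra, evaluated at a product.\<close>

lemma (in group) sum_times_ga_mult:
  "(\<Sum>g\<in>carrier G. F g * ga_mult G f h g) =
   (\<Sum>y\<in>carrier G. \<Sum>z\<in>carrier G. f y * h z * F (y \<otimes> z))"
proof -
  have "(\<Sum>g\<in>carrier G. F g * ga_mult G f h g) =
      (\<Sum>g\<in>carrier G. \<Sum>y\<in>carrier G. f y * h (inv y \<otimes> g) * F g)"
    by (simp add: ga_mult_def sum_distrib_left mult_ac)
  also have "\<dots> = (\<Sum>y\<in>carrier G. \<Sum>g\<in>carrier G. f y * h (inv y \<otimes> g) * F g)"
    by (rule sum.swap)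
  also have "\<dots> = (\<Sum>y\<in>carrier G. \<Sum>z\<in>carrier G. f y * h z * F (y \<otimes> z))"
  proof (rule sum.cong[OF refl])
    fix y assume y: "y \<in> carrier G"
    have "(\<Sum>g\<in>carrier G. f y * h (inv y \<otimes> g) * F g) =
        (\<Sum>z\<in>carrier G. f y * h (inv y \<otimes> (y \<otimes> z)) * F (y \<otimes> z))"
      using sum_translate_left[OF y, of "\<lambda>g. f y * h (inv y \<otimes> g) * F g"] by simp
    also have "\<dots> = (\<Sum>z\<in>carrier G. f y * h z * F (y \<otimes> z))"
      using y by (intro sum.cong) (auto simp: m_assoc[symmetric])
    finally show "(\<Sum>g\<in>carrier G. f y * h (inv y \<otimes> g) * F g) =
        (\<Sum>z\<in>carrier G. f y * h z * F (y \<otimes> z))" .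
  qed
  finally show ?thesis .
qed

lemma (in group) ga_mult_at:
  assumes "x \<in> carrier G"
  shows "ga_mult G f h x = (\<Sum>z\<in>carrier G. f (x \<otimes> inv z) * h z)"
proof -
  have "ga_mult G f h x = (\<Sum>y\<in>carrier G. f y * h (inv y \<otimes> x))"
    using assms by (simp add: ga_mult_def)
  also have "\<dots> = (\<Sum>y\<in>carrier G. f (inv y) * h (y \<otimes> x))"
    using sum_inverse[of "\<lambda>y. f y * h (inv y \<otimes> x)"] by simp
  also have "\<dots> = (\<Sum>z\<in>carrier G. f (inv (z \<otimes> inv x)) * h (z \<otimes> inv x \<otimes> x))"
    using sum_translate_right[of "inv x" "\<lambda>y. f (inv y) * h (y \<otimes> x)"] assms by simp
  also have "\<dots> = (\<Sum>z\<in>carrier G. f (x \<otimes> inv z) * h z)"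
    using assms by (intro sum.cong) (auto simp: inv_mult_group m_assoc)
  finally show ?thesis .
qed

lemma (in group) ga_mult_at_one: "ga_mult G f h \<one> = (\<Sum>y\<in>carrier G. f y * h (inv y))"
  by (auto simp: ga_mult_def intro!: sum.cong)

lemma (in group) ga_mult_assoc:
  "ga_mult G (ga_mult G f h) k = ga_mult G f (ga_mult G h k)"
proof
  fix x
  show "ga_mult G (ga_mult G f h) k x = ga_mult G f (ga_mult G h k) x"
  proof (cases "x \<in> carrier G")
    case True
    have "ga_mult G (ga_mult G f h) k x = (\<Sum>y\<in>carrier G. k (inv y \<otimes> x) * ga_mult G f h y)"
      using True by (simp add: ga_mult_def mult.commute)
    also have "\<dots> = (\<Sum>y\<in>carrier G. \<Sum>z\<in>carrier G. f y * h z * k (inv (y \<otimes> z) \<otimes> x))"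
      by (rule sum_times_ga_mult)
    also have "\<dots> = (\<Sum>y\<in>carrier G. f y * (\<Sum>z\<in>carrier G. h z * k (inv z \<otimes> (inv y \<otimes> x))))"
      using True by (intro sum.cong refl) (auto simp: sum_distrib_left inv_mult_group m_assoc mult.assoc)
    also have "\<dots> = ga_mult G f (ga_mult G h k) x"
      using True by (simp add: ga_mult_def)
    finally show ?thesis .
  qed (simp add: ga_mult_outside)
qed

lemma ga_mult_fun_scale_left: "ga_mult G (fun_scale r f) h = fun_scale r (ga_mult G f h)"
  by (auto simp: ga_mult_def fun_scale_def sum_distrib_left mult_ac)

lemma ga_mult_fun_scale_right: "ga_mult G f (fun_scale r h) = fun_scale r (ga_mult G f h)"
  by (auto simp: ga_mult_def fun_scale_def sum_distrib_left mult_ac)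

lemma ga_mult_add_left: "ga_mult G (f + f') h = ga_mult G f h + ga_mult G f' h"
  by (auto simp: ga_mult_def sum.distrib algebra_simps)

lemma ga_mult_add_right: "ga_mult G f (h + h') = ga_mult G f h + ga_mult G f h'"
  by (auto simp: ga_mult_def sum.distrib algebra_simps)

lemma linear_ga_mult_left: "Vector_Spaces.linear fun_scale fun_scale (\<lambda>h. ga_mult G f h)"
  by unfold_locales (simp_all add: ga_mult_add_right ga_mult_fun_scale_right)

lemma (in group) ga_elem_mult:
  assumes "finite (carrier G)" "g \<in> carrier G" "x \<in> carrier G"
  shows "ga_mult G (ga_elem g) f x = f (inv g \<otimes> x)"
proof -
  have "ga_mult G (ga_elem g) f x = (\<Sum>y\<in>carrier G. if y = g then f (inv g \<otimes> x) else 0)"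
    unfolding ga_mult_def ga_elem_def if_P[OF assms(3)] by (rule sum.cong) simp_all
  also have "\<dots> = f (inv g \<otimes> x)"
    using assms(1,2) by (simp only: sum.delta if_True)
  finally show ?thesis .
qed

lemma (in group) ga_mult_equivariant_left:
  assumes "p \<in> carrier G" "x \<in> carrier G"
    and "\<And>y. y \<in> carrier G \<Longrightarrow> f (p \<otimes> y) = r * f y"
  shows "ga_mult G f h (p \<otimes> x) = r * ga_mult G f h x"
proof -
  have "ga_mult G f h (p \<otimes> x) = (\<Sum>y\<in>carrier G. f (p \<otimes> y) * h (inv (p \<otimes> y) \<otimes> (p \<otimes> x)))"
    using sum_translate_left[of p "\<lambda>y. f y * h (inv y \<otimes> (p \<otimes> x))"] assms
    by (simp add: ga_mult_def)
  also have "\<dots> = (\<Sum>y\<in>carrier G. r * (f y * h (inv y \<otimes> x)))"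
  proof (intro sum.cong refl)
    fix y assume y: "y \<in> carrier G"
    have "inv (p \<otimes> y) \<otimes> (p \<otimes> x) = inv y \<otimes> x"
      using assms(1,2) y by (simp add: inv_mult_group m_assoc inv_mult_cancel)
    then show "f (p \<otimes> y) * h (inv (p \<otimes> y) \<otimes> (p \<otimes> x)) = r * (f y * h (inv y \<otimes> x))"
      using assms y by simp
  qed
  finally show ?thesis
    using assms by (simp add: ga_mult_def sum_distrib_left)
qed

lemma (in group) ga_mult_equivariant_right:
  assumes "q \<in> carrier G" "x \<in> carrier G"
    and "\<And>y. y \<in> carrier G \<Longrightarrow> h (y \<otimes> q) = r * h y"
  shows "ga_mult G f h (x \<otimes> q) = r * ga_mult G f h x"
proof -
  have "h (inv y \<otimes> (x \<otimes> q)) = r * h (inv y \<otimes> x)" if "y \<in> carrier G" for y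
    using assms(3)[of "inv y \<otimes> x"] assms(1,2) that by (simp add: m_assoc)
  then show ?thesis
    using assms(1,2) by (simp add: ga_mult_def sum_distrib_left mult_ac)
qed

text \<open>For real coefficients the adjoint of \<open>f\<close> is \<open>x \<mapsto> f (inv x)\<close>, and the coefficient of the
  identity in \<open>f\<close> times its adjoint is a sum of squares.\<close>

lemma (in group) ga_mult_adjoint_eq_0:
  assumes "finite (carrier G)" "f \<in> group_algebra G"
    and "\<And>x. x \<in> carrier G \<Longrightarrow> f x \<in> \<real>"
    and "\<And>x. x \<in> carrier G \<Longrightarrow> h x = f (inv x)"
    and "ga_mult G f h = 0"
  shows "f = 0"
proof
  fix x
  have "(\<Sum>y\<in>carrier G. (Re (f y))\<^sup>2) = Re (\<Sum>y\<in>carrier G. f y * h (inv y))"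
    using assms(3,4) by (simp add: power2_eq_square complex_is_Real_iff)
  also have "\<dots> = 0"
    using assms(5) by (simp flip: ga_mult_at_one)
  finally have "\<forall>y\<in>carrier G. (Re (f y))\<^sup>2 = 0"
    using assms(1) by (simp add: sum_nonneg_eq_0_iff)
  then show "f x = 0 x"
    using assms(2,3) by (cases "x \<in> carrier G") (auto simp: group_algebra_def complex_eq_iff complex_is_Real_iff)
qed

lemma (in group) ga_mult_inverse:
  assumes "x \<in> carrier G"
  shows "ga_mult G f h (inv x) = ga_mult G (\<lambda>y. h (inv y)) (\<lambda>y. f (inv y)) x"
proof -
  have "ga_mult G f h (inv x) = (\<Sum>z\<in>carrier G. f (inv x \<otimes> inv z) * h z)"
    using assms by (simp add: ga_mult_at)
  also have "\<dots> = (\<Sum>z\<in>carrier G. f (inv x \<otimes> z) * h (inv z))"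
    using sum_inverse[of "\<lambda>z. f (inv x \<otimes> inv z) * h z"] by simp
  also have "\<dots> = ga_mult G (\<lambda>y. h (inv y)) (\<lambda>y. f (inv y)) x"
    using assms by (auto simp: ga_mult_def inv_mult_group mult.commute intro!: sum.cong)
  finally show ?thesis .
qed

lemma ga_mult_cong:
  assumes "\<And>x. x \<in> carrier G \<Longrightarrow> f x = f' x"
    and "\<And>x. x \<in> carrier G \<Longrightarrow> h x = h' x" and "group G"
  shows "ga_mult G f h = ga_mult G f' h'"
proof -
  interpret group G by fact
  show ?thesis using assms(1,2) by (auto simp: ga_mult_def fun_eq_iff intro!: sum.cong)
qed

lemma (in group) ga_mult_Reals:
  assumes "\<And>x. x \<in> carrier G \<Longrightarrow> f x \<in> \<real>" "\<And>x. x \<in> carrier G \<Longrightarrow> h x \<in> \<real>"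
  shows "ga_mult G f h x \<in> \<real>"
  using assms by (auto simp: ga_mult_def intro!: sum_in_Reals Reals_mult)

text \<open>Let \<open>c = a b\<close>. If \<open>c\<^sup>2 = 0\<close>, then the selfadjoint element \<open>x = a b a\<close> has \<open>x\<^sup>2 = 0\<close>, hence
  vanishes; then \<open>c\<close> times its adjoint \<open>b a\<close> is a multiple of \<open>x\<close> and \<open>c\<close> vanishes as well.\<close>

lemma (in group) ga_square_nonzero:
  assumes fin: "finite (carrier G)"
    and real: "\<And>x. x \<in> carrier G \<Longrightarrow> a x \<in> \<real>" "\<And>x. x \<in> carrier G \<Longrightarrow> b x \<in> \<real>"
    and sym: "\<And>x. x \<in> carrier G \<Longrightarrow> a (inv x) = a x" "\<And>x. x \<in> carrier G \<Longrightarrow> b (inv x) = b x"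
    and idem: "ga_mult G a a = fun_scale r a" "ga_mult G b b = fun_scale s b"
    and nz: "ga_mult G a b \<noteq> 0"
  shows "ga_mult G (ga_mult G a b) (ga_mult G a b) \<noteq> 0"
proof
  let ?m = "ga_mult G"
  assume sq: "?m (?m a b) (?m a b) = 0"
  define x where "x = ?m (?m a b) a"
  have adj: "?m a b (inv g) = ?m b a g" if "g \<in> carrier G" for g
    using ga_mult_inverse[OF that, of a b] ga_mult_cong[of G "\<lambda>y. b (inv y)" b "\<lambda>y. a (inv y)" a]
      sym is_group by simp
  have xadj: "x (inv g) = x g" if "g \<in> carrier G" for g
    using ga_mult_inverse[OF that, of "?m a b" a]
      ga_mult_cong[of G "\<lambda>y. a (inv y)" a "\<lambda>y. ?m a b (inv y)" "?m b a"] sym adj is_group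
    by (simp add: x_def ga_mult_assoc)
  have zero: "?m 0 f = 0" "?m f 0 = 0" "fun_scale t 0 = 0" for f t
    by (auto simp: ga_mult_def fun_scale_def)
  have "?m x x = ?m (?m (?m a b) (?m a a)) (?m b a)"
    by (simp add: x_def ga_mult_assoc)
  also have "\<dots> = fun_scale r (?m (?m (?m a b) (?m a b)) a)"
    by (simp add: idem ga_mult_fun_scale_left ga_mult_fun_scale_right ga_mult_assoc)
  also have "\<dots> = 0"
    by (simp add: sq zero)
  finally have "x = 0"
    using ga_mult_adjoint_eq_0[OF fin, of x x] real xadj
    by (simp add: x_def ga_mult_in_group_algebra ga_mult_Reals)
  moreover have "?m (?m a b) (?m b a) = fun_scale s x"
    by (simp add: x_def idem ga_mult_fun_scale_left ga_mult_fun_scale_right ga_mult_assoc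
        flip: ga_mult_assoc[of b b])
  ultimately have "?m (?m a b) (?m b a) = 0"
    by (simp add: zero)
  then have "?m a b = 0"
    using ga_mult_adjoint_eq_0[OF fin, of "?m a b" "?m b a"] real adj
    by (simp add: ga_mult_in_group_algebra ga_mult_Reals)
  with nz show False ..
qed

section \<open>The character of a left ideal\<close>

text \<open>The trace of \<open>T\<close> on \<open>V\<close> is the trace of \<open>T \<circ> E\<close> on the ambient space, because
  the projection \<open>E\<close> restricts to the identity on \<open>V\<close>.\<close>

lemma trace_on_eq_trace_of_projection:
  assumes fin: "finite S"
    and supp: "\<And>f x. f \<in> V \<Longrightarrow> x \<notin> S \<Longrightarrow> f x = 0"
    and subV: "cfun.subspace V"
    and linT: "Vector_Spaces.linear fun_scale fun_scale T"
    and linE: "Vector_Spaces.linear fun_scale fun_scale E"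
    and fixV: "\<And>f. f \<in> V \<Longrightarrow> E f = f"
    and inV: "\<And>x. x \<in> S \<Longrightarrow> T (E (ga_elem x)) \<in> V"
  shows "trace_on V T = (\<Sum>x\<in>S. T (E (ga_elem x)) x)"
proof -
  define B where "B = (SOME B. cfun.independent B \<and> cfun.span B = V)"
  have "\<exists>B. cfun.independent B \<and> cfun.span B = V"
    by (metis cfun.maximal_independent_subset cfun.span_minimal subV subset_antisym)
  then have B: "cfun.independent B" "cfun.span B = V"
    unfolding B_def by (metis (mono_tags, lifting) someI_ex)+
  let ?rep = "cfun.representation B"
  interpret TE: Vector_Spaces.linear fun_scale fun_scale "T \<circ> E"
    using linE linT by (rule Vector_Spaces.linear_compose)
  have expand: "f = (\<Sum>x\<in>S. fun_scale (f x) (ga_elem x))" if "f \<in> V" for f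
    using fin supp[OF that]
    by (auto simp: sum_fun_eval fun_scale_def ga_elem_def if_distrib cong: if_cong)
  have finB: "finite B"
  proof -
    have "f \<in> cfun.span (ga_elem ` S)" if "f \<in> B" for f
    proof -
      have "f \<in> V" using that B(2) cfun.span_base by blast
      from expand[OF this] show ?thesis
        by (metis (no_types, lifting) cfun.span_base cfun.span_scale cfun.span_sum imageI)
    qed
    then show ?thesis
      using cfun.independent_span_bound[OF _ B(1), of "ga_elem ` S"] fin by blast
  qed
  have diag: "?rep (T b) b = (\<Sum>x\<in>S. b x * ?rep (T (E (ga_elem x))) b)" if b: "b \<in> B" for b
  proof -
    have bV: "b \<in> V" using b B(2) cfun.span_base by blast
    have "T b = (T \<circ> E) (\<Sum>x\<in>S. fun_scale (b x) (ga_elem x))"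
      using expand[OF bV] fixV[OF bV] by simp
    also have "\<dots> = (\<Sum>x\<in>S. fun_scale (b x) ((T \<circ> E) (ga_elem x)))"
      by (simp only: TE.sum TE.scale)
    finally have "?rep (T b) = ?rep (\<Sum>x\<in>S. fun_scale (b x) (T (E (ga_elem x))))"
      by (simp only: o_apply)
    also have "\<dots> = (\<lambda>b'. \<Sum>x\<in>S. ?rep (fun_scale (b x) (T (E (ga_elem x)))) b')"
      using inV B by (intro cfun.representation_sum) (auto intro: cfun.span_scale)
    finally show ?thesis
      using inV B by (simp add: cfun.representation_scale)
  qed
  have "trace_on V T = (\<Sum>b\<in>B. ?rep (T b) b)"
    by (simp add: trace_on_def B_def Let_def)
  also have "\<dots> = (\<Sum>x\<in>S. \<Sum>b\<in>B. ?rep (T (E (ga_elem x))) b * b x)"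
    using diag by (subst sum.swap) (simp add: mult.commute)
  also have "\<dots> = (\<Sum>x\<in>S. T (E (ga_elem x)) x)"
  proof (rule sum.cong[OF refl])
    fix x assume "x \<in> S"
    then have "(\<Sum>b\<in>B. fun_scale (?rep (T (E (ga_elem x))) b) b) = T (E (ga_elem x))"
      using inV B finB by (intro cfun.sum_representation_eq) auto
    from fun_cong[OF this, of x] show "(\<Sum>b\<in>B. ?rep (T (E (ga_elem x))) b * b x) = T (E (ga_elem x)) x"
      by (simp add: sum_fun_eval fun_scale_def)
  qed
  finally show ?thesis .
qed

text \<open>Since \<open>c\<^sup>2 = k c\<close>, right multiplication by \<open>c / k\<close> is a projection onto the left ideal of \<open>c\<close>, so
  the trace can be taken in the basis of group elements of the whole group algebra.\<close>

lemma (in group) left_ideal_char_eq: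
  assumes fin: "finite (carrier G)"
    and quasi: "ga_mult G c c = fun_scale k c" and k: "k \<noteq> 0"
    and g: "g \<in> carrier G"
  shows "left_ideal_char G ((\<lambda>f. ga_mult G f c) ` group_algebra G) g =
    (1 / k) * (\<Sum>x\<in>carrier G. c (inv x \<otimes> inv g \<otimes> x))"
proof -
  define V where "V = (\<lambda>f. ga_mult G f c) ` group_algebra G"
  define E where "E = (\<lambda>f. fun_scale (1 / k) (ga_mult G f c))"
  define T where "T = ga_mult G (ga_elem g)"
  have scaleV: "fun_scale r (ga_mult G f c) \<in> V" for f r
  proof -
    \<comment> \<open>cut \<open>f\<close> down to its values on the group\<close>
    define f' where "f' = fun_scale r (\<lambda>x. if x \<in> carrier G then f x else 0)"
    have "fun_scale r (ga_mult G f c) = ga_mult G f' c"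
      by (auto simp: f'_def ga_mult_def fun_scale_def sum_distrib_left mult.assoc intro!: sum.cong)
    moreover have "f' \<in> group_algebra G"
      by (simp add: f'_def group_algebra_def fun_scale_def)
    ultimately show ?thesis unfolding V_def by blast
  qed
  have multV: "ga_mult G f c \<in> V" for f
    using scaleV[of 1 f] by (simp add: fun_scale_def)
  have "cfun.subspace V"
  proof (rule cfun.subspaceI)
    show "0 \<in> V" using scaleV[of 0] by (simp add: fun_scale_def zero_fun_def)
    show "u + v \<in> V" if "u \<in> V" "v \<in> V" for u v
      using that multV by (auto simp: V_def simp flip: ga_mult_add_left)
    show "fun_scale r u \<in> V" if "u \<in> V" for r u
      using that scaleV by (auto simp: V_def)
  qed
  moreover have "Vector_Spaces.linear fun_scale fun_scale E"
    by unfold_locales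
      (simp_all add: E_def ga_mult_add_left ga_mult_fun_scale_left cfun.scale_right_distrib mult.commute)
  moreover have "Vector_Spaces.linear fun_scale fun_scale T"
    unfolding T_def by (rule linear_ga_mult_left)
  moreover have "E f = f" if f: "f \<in> V" for f
  proof -
    obtain f0 where f0: "f = ga_mult G f0 c" using f by (auto simp: V_def)
    have "ga_mult G f c = fun_scale k f"
      by (simp add: f0 ga_mult_assoc quasi ga_mult_fun_scale_right)
    then show ?thesis using k by (simp add: E_def fun_scale_def)
  qed
  moreover have "T (E (ga_elem x)) \<in> V" for x
    by (simp add: T_def E_def ga_mult_fun_scale_right scaleV flip: ga_mult_assoc)
  ultimately have "trace_on V T = (\<Sum>x\<in>carrier G. T (E (ga_elem x)) x)"
    by (intro trace_on_eq_trace_of_projection[OF fin]) (auto simp: V_def ga_mult_outside)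
  also have "\<dots> = (\<Sum>x\<in>carrier G. (1 / k) * c (inv x \<otimes> inv g \<otimes> x))"
    using g fin by (intro sum.cong) (auto simp: T_def E_def ga_elem_mult fun_scale_def m_assoc)
  finally show ?thesis
    by (simp add: left_ideal_char_def V_def T_def sum_distrib_left)
qed

text \<open>Conjugating the summation variable turns each of the \<open>card (carrier G)\<close> terms of the character
  formula into the same sum. This reduces a multiplicity to one linear functional of \<open>c\<close>.\<close>

lemma (in group) char_inner_left_ideal:
  assumes fin: "finite (carrier G)"
    and quasi: "ga_mult G c c = fun_scale k c" and k: "k \<noteq> 0" "k \<in> \<real>"
    and real: "\<And>x. x \<in> carrier G \<Longrightarrow> c x \<in> \<real>"
    and conj: "\<And>x g. x \<in> carrier G \<Longrightarrow> g \<in> carrier G \<Longrightarrow> f (x \<otimes> g \<otimes> inv x) = f g"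
    and finv: "\<And>g. g \<in> carrier G \<Longrightarrow> f (inv g) = f g"
  shows "char_inner G f (left_ideal_char G ((\<lambda>f. ga_mult G f c) ` group_algebra G)) =
    (1 / k) * (\<Sum>g\<in>carrier G. f g * c g)"
proof -
  define N where "N = (of_nat (card (carrier G)) :: complex)"
  have N: "N \<noteq> 0" using fin one_closed by (auto simp: N_def)
  have "(\<Sum>g\<in>carrier G. f g * cnj (left_ideal_char G ((\<lambda>f. ga_mult G f c) ` group_algebra G) g)) =
      (\<Sum>g\<in>carrier G. f g * ((1 / k) * (\<Sum>x\<in>carrier G. c (inv x \<otimes> inv g \<otimes> x))))"
    using real k by (auto intro!: sum.cong simp: left_ideal_char_eq[OF fin quasi] Reals_cnj_iff)
  also have "\<dots> = (1 / k) * (\<Sum>x\<in>carrier G. \<Sum>g\<in>carrier G. f g * c (inv x \<otimes> inv g \<otimes> x))"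
    by (subst sum.swap) (simp add: sum_distrib_left mult_ac)
  also have "(\<Sum>x\<in>carrier G. \<Sum>g\<in>carrier G. f g * c (inv x \<otimes> inv g \<otimes> x)) =
      (\<Sum>x\<in>carrier G. \<Sum>g\<in>carrier G. f g * c g)"
  proof (rule sum.cong[OF refl])
    fix x assume x: "x \<in> carrier G"
    have "(\<Sum>g\<in>carrier G. f g * c (inv x \<otimes> inv g \<otimes> x)) =
        (\<Sum>g\<in>carrier G. f (x \<otimes> inv g \<otimes> inv x) * c g)"
      by (rule sum.reindex_bij_witness[where i = "\<lambda>g. x \<otimes> inv g \<otimes> inv x"
            and j = "\<lambda>g. inv x \<otimes> inv g \<otimes> x"])
        (use x in \<open>auto simp: inv_mult_group m_assoc inv_mult_cancel\<close>)
    also have "\<dots> = (\<Sum>g\<in>carrier G. f g * c g)"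
      using x conj finv by (intro sum.cong) auto
    finally show "(\<Sum>g\<in>carrier G. f g * c (inv x \<otimes> inv g \<otimes> x)) = (\<Sum>g\<in>carrier G. f g * c g)" .
  qed
  also have "\<dots> = N * (\<Sum>g\<in>carrier G. f g * c g)"
    by (simp add: N_def)
  finally show ?thesis
    using N by (simp add: char_inner_def flip: N_def)
qed

section \<open>Words and their rearrangements\<close>

definition word_stabilizer :: "nat \<Rightarrow> (nat \<Rightarrow> 'l) \<Rightarrow> (nat \<Rightarrow> nat) set"
  where "word_stabilizer n w = {p. p permutes {1..n} \<and> w \<circ> p = w}"

definition rearrangements :: "nat \<Rightarrow> (nat \<Rightarrow> 'l) \<Rightarrow> (nat \<Rightarrow> 'l) set"
  where "rearrangements n w = (\<lambda>p. w \<circ> p) ` {p. p permutes {1..n}}"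

lemma comp_permutes_inv:
  assumes "p permutes S"
  shows "p \<circ> inv' p = id" "inv' p \<circ> p = id"
    "(u \<circ> p) \<circ> inv' p = u" "(u \<circ> inv' p) \<circ> p = u"
  using permutes_inv_o[OF assms] by (simp_all add: comp_assoc)

lemma comp_eq_comp_permutes:
  assumes "p permutes S"
  shows "u \<circ> p = v \<longleftrightarrow> u = v \<circ> inv' p"
  by (metis assms comp_permutes_inv(3,4))

lemma finite_sym_group: "finite (carrier (sym_group n))"
  by (simp add: sym_group_def finite_permutations)

lemma word_stabilizer_subgroup: "subgroup (word_stabilizer n w) (sym_group n)"
proof -
  interpret group "sym_group n" by (rule sym_group_is_group)
  show ?thesis
  proof (rule subgroupI)
    show "word_stabilizer n w \<subseteq> carrier (sym_group n)"
      by (auto simp: word_stabilizer_def sym_group_carrier)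
    show "word_stabilizer n w \<noteq> {}"
      using permutes_id[of "{1..n}"] by (auto simp: word_stabilizer_def intro!: exI[of _ id])
    show "inv\<^bsub>sym_group n\<^esub> p \<in> word_stabilizer n w" if "p \<in> word_stabilizer n w" for p
      using that comp_eq_comp_permutes[of p "{1..n}" w w]
      by (simp add: word_stabilizer_def sym_group_carrier permutes_inv)
    show "p \<otimes>\<^bsub>sym_group n\<^esub> q \<in> word_stabilizer n w"
      if "p \<in> word_stabilizer n w" "q \<in> word_stabilizer n w" for p q
      using that by (simp add: word_stabilizer_def sym_group_mult permutes_compose flip: comp_assoc)
  qed
qed

lemma finite_word_stabilizer: "finite (word_stabilizer n w)"
  using finite_sym_group subgroup.subset[OF word_stabilizer_subgroup] by (rule finite_subset[rotated])

lemma word_stabilizer_permutes: "p \<in> word_stabilizer n w \<Longrightarrow> p permutes {1..n}"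
  by (simp add: word_stabilizer_def)

lemma finite_rearrangements: "finite (rearrangements n w)"
  by (simp add: rearrangements_def finite_permutations)

lemma rearrangements_comp:
  assumes "u \<in> rearrangements n w" "p permutes {1..n}"
  shows "u \<circ> p \<in> rearrangements n w"
  using assms by (auto simp: rearrangements_def comp_assoc intro!: image_eqI permutes_compose)

lemma rearrangements_outside:
  assumes "u \<in> rearrangements n w" "t \<notin> {1..n}"
  shows "u t = w t"
proof -
  obtain p where "p permutes {1..n}" "u = w \<circ> p"
    using assms(1) by (auto simp: rearrangements_def)
  then show ?thesis using permutes_not_in[OF _ assms(2), of p] by simp
qed

lemma rearrangements_image: "u \<in> rearrangements n w \<Longrightarrow> u ` {1..n} = w ` {1..n}"
  using permutes_image by (fastforce simp: rearrangements_def simp flip: image_image)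

lemma rearrangements_sum:
  fixes f :: "'l \<Rightarrow> real"
  assumes "u \<in> rearrangements n w"
  shows "(\<Sum>t\<in>{1..n}. f (u t)) = (\<Sum>t\<in>{1..n}. f (w t))"
proof -
  obtain p where "p permutes {1..n}" "u = w \<circ> p"
    using assms by (auto simp: rearrangements_def)
  then show ?thesis
    using sum.permute[of p "{1..n}" "\<lambda>t. f (w t)"] by (simp add: o_def)
qed

lemma count_image_mset_set:
  assumes "finite A"
  shows "count (image_mset f (mset_set A)) x = card {t \<in> A. f t = x}"
proof -
  have "count (image_mset f (mset_set A)) x = (\<Sum>t\<in>{t \<in> A. f t = x}. count (mset_set A) t)"
    unfolding count_image_mset' using assms by (intro sum.cong) auto
  also have "\<dots> = (\<Sum>t\<in>{t \<in> A. f t = x}. 1)"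
    using assms by (intro sum.cong) auto
  finally show ?thesis by simp
qed

lemma rearrangementsI_card:
  assumes out: "\<And>t. t \<notin> {1..n} \<Longrightarrow> u t = w t"
    and card: "\<And>x. card {t \<in> {1..n}. u t = x} = card {t \<in> {1..n}. w t = x}"
  shows "u \<in> rearrangements n w"
proof -
  have "image_mset u (mset_set {1..n}) = image_mset w (mset_set {1..n})"
    using card by (simp add: multiset_eq_iff count_image_mset_set)
  then obtain p where p: "p permutes {1..n}" "\<forall>t\<in>{1..n}. u t = w (p t)"
    by (rule image_mset_eq_implies_permutes[OF finite_atLeastAtMost])
  have "u = w \<circ> p"
  proof
    fix t show "u t = (w \<circ> p) t"
      using p out permutes_not_in[OF p(1), of t] by (cases "t \<in> {1..n}") auto
  qed
  with p(1) show ?thesis by (auto simp: rearrangements_def)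
qed

text \<open>The cosets of the stabilizer of \<open>w\<close> correspond to the rearrangements of \<open>w\<close>, and \<open>g\<close> fixes
  a coset when it fixes the corresponding word.\<close>

lemma induced_trivial_char_eq_card_fixed:
  assumes g: "g permutes {1..n}"
  shows "induced_char (sym_group n) (word_stabilizer n w) (\<lambda>_. 1) g =
    of_nat (card {u \<in> rearrangements n w. u \<circ> g = u})"
proof -
  interpret group "sym_group n" by (rule sym_group_is_group)
  let ?P = "{p. p permutes {1..n}}" and ?H = "word_stabilizer n w"
  have fP: "finite ?P" by (simp add: finite_permutations)
  have mem: "inv' x \<otimes>\<^bsub>sym_group n\<^esub> g \<otimes>\<^bsub>sym_group n\<^esub> x \<in> ?H \<longleftrightarrow>
      (w \<circ> inv' x) \<circ> g = w \<circ> inv' x" if x: "x permutes {1..n}" for x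
  proof -
    have "inv' x \<circ> g \<circ> x permutes {1..n}"
      using x g by (intro permutes_compose permutes_inv)
    moreover have "w \<circ> (inv' x \<circ> g \<circ> x) = w \<longleftrightarrow> (w \<circ> inv' x) \<circ> g = w \<circ> inv' x"
      using comp_eq_comp_permutes[OF x, of "w \<circ> inv' x \<circ> g" w] by (simp add: comp_assoc)
    ultimately show ?thesis
      using x by (simp add: word_stabilizer_def sym_group_carrier sym_group_mult)
  qed
  have fiber: "card {x \<in> ?P. w \<circ> x = u} = card ?H" if "u \<in> rearrangements n w" for u
  proof -
    obtain y where y: "y permutes {1..n}" "u = w \<circ> y"
      using \<open>u \<in> _\<close> by (auto simp: rearrangements_def)
    have "bij_betw (\<lambda>h. h \<circ> y) ?H {x \<in> ?P. w \<circ> x = u}"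
    proof (rule bij_betw_byWitness[where f' = "\<lambda>x. x \<circ> inv' y"])
      show "(\<lambda>h. h \<circ> y) ` ?H \<subseteq> {x \<in> ?P. w \<circ> x = u}"
        using y by (auto simp: word_stabilizer_def permutes_compose simp flip: comp_assoc)
      show "(\<lambda>x. x \<circ> inv' y) ` {x \<in> ?P. w \<circ> x = u} \<subseteq> ?H"
        using y comp_permutes_inv[OF y(1)]
        by (auto simp: word_stabilizer_def permutes_compose permutes_inv simp flip: comp_assoc)
    qed (use comp_permutes_inv[OF y(1)] in auto)
    then show ?thesis by (simp add: bij_betw_same_card)
  qed
  have H0: "card ?H \<noteq> 0"
    using finite_word_stabilizer[of n w] subgroup.one_closed[OF word_stabilizer_subgroup[of n w]] by auto
  have "(\<Sum>x\<in>?P. if (w \<circ> inv' x) \<circ> g = w \<circ> inv' x then 1 else (0::complex)) =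
      (\<Sum>x\<in>?P. if (w \<circ> x) \<circ> g = w \<circ> x then 1 else 0)"
    by (rule sum.reindex_bij_witness[where i = inv' and j = inv'])
      (auto simp: permutes_inv permutes_inv_inv)
  also have "\<dots> = (\<Sum>u\<in>rearrangements n w. \<Sum>x\<in>{x \<in> ?P. w \<circ> x = u}.
      if (w \<circ> x) \<circ> g = w \<circ> x then 1 else 0)"
    unfolding rearrangements_def by (rule sum.image_gen[OF fP])
  also have "\<dots> = (\<Sum>u\<in>rearrangements n w. of_nat (card ?H) * (if u \<circ> g = u then 1 else 0))"
    using fiber by (intro sum.cong refl) (simp add: sum.If_cases)
  also have "\<dots> = of_nat (card ?H) * of_nat (card {u \<in> rearrangements n w. u \<circ> g = u})"
    by (simp add: finite_rearrangements sum.If_cases Int_def flip: sum_distrib_left)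
  finally have *: "(\<Sum>x\<in>?P. if (w \<circ> inv' x) \<circ> g = w \<circ> inv' x then 1 else (0::complex)) =
      of_nat (card ?H) * of_nat (card {u \<in> rearrangements n w. u \<circ> g = u})" .
  have "induced_char (sym_group n) ?H (\<lambda>_. 1) g =
      (1 / of_nat (card ?H)) * (\<Sum>x\<in>?P. if (w \<circ> inv' x) \<circ> g = w \<circ> inv' x then 1 else 0)"
    unfolding induced_char_def
    by (intro arg_cong2[where f = "(*)"] refl sum.cong if_cong) (simp_all add: sym_group_carrier mem set_eq_iff)
  then show ?thesis
    using H0 by (simp add: *)
qed

section \<open>Words with distinct letters in each column\<close>

text \<open>Replacing the letters of \<open>S - T\<close> by those of \<open>T - S\<close> can only increase the weight.\<close>

lemma sum_top_set:
  fixes z :: "'l \<Rightarrow> real"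
  assumes "finite S" "finite T" "card S = card T"
    and top: "\<And>c d. c \<in> T \<Longrightarrow> d \<in> S \<Longrightarrow> d \<notin> T \<Longrightarrow> z d < z c"
  shows "sum z S \<le> sum z T" and "sum z S = sum z T \<Longrightarrow> S = T"
proof -
  have card: "card (S - T) = card (T - S)"
    using assms(1-3) by (metis Int_commute card_Diff_subset_Int finite_Int)
  then obtain f where f: "bij_betw f (S - T) (T - S)"
    using assms(1,2) finite_same_card_bij[of "S - T" "T - S"] by auto
  have less: "z d < z (f d)" if "d \<in> S - T" for d
    using top[of "f d" d] bij_betwE[OF f] that by blast
  have split: "sum z S = sum z (S - T) + sum z (S \<inter> T)" "sum z T = sum z (T - S) + sum z (S \<inter> T)"
    using assms(1,2) sum.Int_Diff[of S z T] sum.Int_Diff[of T z S] by (simp_all add: Int_commute)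
  have img: "sum z (T - S) = (\<Sum>d\<in>S - T. z (f d))"
    using sum.reindex_bij_betw[OF f, of z] by simp
  show "sum z S \<le> sum z T"
    unfolding split img using less by (auto intro: sum_mono less_imp_le)
  assume "sum z S = sum z T"
  then have "S - T = {}"
    using sum_strict_mono[of "S - T" z "\<lambda>d. z (f d)"] less assms(1) unfolding split img by force
  then have "S \<subseteq> T" by blast
  then show "S = T"
    using assms(2,3) by (simp add: card_subset_eq)
qed

text \<open>In each column \<open>u0\<close> carries the letters of largest weight. A word \<open>u\<close> with distinct letters in
  each column therefore has at most the weight of \<open>u0\<close> there; as the total weights agree,
  \<open>u\<close> and \<open>u0\<close> carry the same letters in every column.\<close>

lemma column_rearrangement:
  fixes u u0 :: "nat \<Rightarrow> 'l" and col :: "nat \<Rightarrow> nat" and z :: "'l \<Rightarrow> real"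
  assumes inj: "inj_on (\<lambda>t. (u t, col t)) {1..n}" "inj_on (\<lambda>t. (u0 t, col t)) {1..n}"
    and out: "\<And>t. t \<notin> {1..n} \<Longrightarrow> u t = u0 t"
    and top: "\<And>s t. s \<in> {1..n} \<Longrightarrow> t \<in> {1..n} \<Longrightarrow>
      (\<And>t'. t' \<in> {1..n} \<Longrightarrow> col t' = col s \<Longrightarrow> u0 t' \<noteq> u t) \<Longrightarrow> z (u t) < z (u0 s)"
    and weight: "(\<Sum>t\<in>{1..n}. z (u t)) = (\<Sum>t\<in>{1..n}. z (u0 t))"
  shows "\<exists>q\<in>word_stabilizer n col. u = u0 \<circ> q"
proof -
  define D where "D j = {t \<in> {1..n}. col t = j}" for j
  have injD: "inj_on u (D j)" "inj_on u0 (D j)" for j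
    by (rule inj_onI; use inj in \<open>auto simp: D_def dest: inj_onD\<close>)+
  have fD: "finite (D j)" for j by (simp add: D_def)
  have cards: "card (u ` D j) = card (u0 ` D j)" for j
    using injD by (simp add: card_image)
  have top': "z d < z c" if "c \<in> u0 ` D j" "d \<in> u ` D j" "d \<notin> u0 ` D j" for c d j
  proof -
    obtain s t where "s \<in> D j" "t \<in> D j" "c = u0 s" "d = u t" using \<open>c \<in> _\<close> \<open>d \<in> u ` _\<close> by blast
    moreover from this have "z (u t) < z (u0 s)"
      using that(3) by (intro top) (auto simp: D_def image_iff)
    ultimately show ?thesis by simp
  qed
  have le: "(\<Sum>t\<in>D j. z (u t)) \<le> (\<Sum>t\<in>D j. z (u0 t))" for j
    using sum_top_set(1)[of "u ` D j" "u0 ` D j" z] fD cards top' injD[of j]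
    by (simp add: sum.reindex)
  have "(\<Sum>j\<in>col ` {1..n}. \<Sum>t\<in>D j. z (u t)) = (\<Sum>j\<in>col ` {1..n}. \<Sum>t\<in>D j. z (u0 t))"
    using weight sum.image_gen[of "{1..n}" "\<lambda>t. z (u t)" col] sum.image_gen[of "{1..n}" "\<lambda>t. z (u0 t)" col]
    by (simp only: D_def finite_atLeastAtMost)
  from sum_mono_inv[OF this le]
  have eq: "(\<Sum>t\<in>D j. z (u t)) = (\<Sum>t\<in>D j. z (u0 t))" if "j \<in> col ` {1..n}" for j
    using that by simp
  have same: "u ` D j = u0 ` D j" if "j \<in> col ` {1..n}" for j
    using sum_top_set(2)[of "u ` D j" "u0 ` D j" z] fD cards top' injD[of j] eq[OF that]
    by (simp add: sum.reindex)
  have "(\<lambda>t. (u t, col t)) ` {1..n} = (\<lambda>t. (u0 t, col t)) ` {1..n}"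
  proof (intro equalityI image_subsetI)
    fix t assume t: "t \<in> {1..n}"
    then have "u t \<in> u0 ` D (col t)" "u0 t \<in> u ` D (col t)"
      using same[of "col t"] by (auto simp: D_def)
    then show "(u t, col t) \<in> (\<lambda>t. (u0 t, col t)) ` {1..n}"
      "(u0 t, col t) \<in> (\<lambda>t. (u t, col t)) ` {1..n}"
      by (auto simp: D_def)
  qed
  then have "image_mset (\<lambda>t. (u t, col t)) (mset_set {1..n}) = image_mset (\<lambda>t. (u0 t, col t)) (mset_set {1..n})"
    using inj by (simp add: image_mset_mset_set)
  then obtain q where q: "q permutes {1..n}" "\<forall>t\<in>{1..n}. (u t, col t) = (u0 (q t), col (q t))"
    by (rule image_mset_eq_implies_permutes[OF finite_atLeastAtMost])
  have "u = u0 \<circ> q \<and> col \<circ> q = col"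
  proof -
    have "u t = u0 (q t) \<and> col (q t) = col t" for t
      using q out permutes_not_in[OF q(1), of t] by (cases "t \<in> {1..n}") auto
    then show ?thesis by (auto simp: fun_eq_iff)
  qed
  with q(1) show ?thesis by (auto simp: word_stabilizer_def)
qed

text \<open>If two points of a column carry the same letter, composing with their transposition pairs off the
  terms of opposite sign.\<close>

lemma sum_sign_cancels:
  fixes u v :: "nat \<Rightarrow> 'l" and col :: "nat \<Rightarrow> nat"
  assumes "s \<in> {1..n}" "t \<in> {1..n}" "s \<noteq> t" "u s = u t" "col s = col t"
  shows "(\<Sum>q\<in>word_stabilizer n col. of_int (sign q) * (if u \<circ> q = v then 1 else 0)) = (0::complex)"
proof -
  interpret group "sym_group n" by (rule sym_group_is_group)
  let ?C = "word_stabilizer n col" and ?t = "transpose s t"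
  let ?F = "\<lambda>q. of_int (sign q) * (if u \<circ> q = v then 1 else 0) :: complex"
  have swap: "f \<circ> ?t = f" if "f s = f t" for f :: "nat \<Rightarrow> 'z"
    using that by (auto simp: fun_eq_iff transpose_def)
  have tC: "?t \<in> ?C"
    using assms swap[of col] by (simp add: word_stabilizer_def permutes_swap_id)
  have neg: "?F (?t \<circ> q) = - ?F q" if "q \<in> ?C" for q
  proof -
    have "permutation q"
      using that permutation_permutes word_stabilizer_permutes by blast
    then have "sign (?t \<circ> q) = - sign q"
      using assms(3) by (simp add: sign_compose sign_swap_id permutation_swap_id)
    moreover have "u \<circ> (?t \<circ> q) = u \<circ> q"
      using swap[of u] assms(4) by (simp flip: comp_assoc)
    ultimately show ?thesis by simp
  qed
  have "(\<Sum>q\<in>?C. ?F q) = (\<Sum>q\<in>?C. ?F (?t \<circ> q))"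
    using sum_subgroup_translate_left[OF word_stabilizer_subgroup tC, of ?F] by (simp add: sym_group_mult)
  also have "\<dots> = - (\<Sum>q\<in>?C. ?F q)"
    by (simp add: neg sum_negf)
  finally show ?thesis by simp
qed

section \<open>The canonical tableau\<close>

text \<open>On these boxes \<open>canon_tableau\<close> is a bijective numbering, whose inverse gives the row and the column
  of a number. The resulting row word and column word have the Young subgroup and the column subgroup
  as their stabilizers.\<close>

definition cells :: "nat list \<Rightarrow> (nat \<times> nat) set"
  where "cells \<mu> = (SIGMA i:{..<length \<mu>}. {..<\<mu> ! i})"

lemma canon_tableau_bij:
  "bij_betw (\<lambda>(i, j). canon_tableau \<mu> i j) (cells \<mu>) {1..sum_list \<mu>}"
proof -
  let ?f = "\<lambda>(i, j). canon_tableau \<mu> i j"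
  have next_row: "canon_tableau \<mu> i j \<le> sum_list (take i' \<mu>)"
    if "i < i'" "i' \<le> length \<mu>" "j < \<mu> ! i" for i i' j
  proof -
    have "canon_tableau \<mu> i j \<le> sum_list (take (Suc i) \<mu>)"
      using that by (simp add: canon_tableau_def take_Suc_conv_app_nth)
    also have "sum_list (take (Suc i) \<mu>) \<le> sum_list (take i' \<mu>)"
      using that le_add_diff_inverse[of "Suc i" i'] by (metis Suc_leI le_add1 sum_list_append take_add)
    finally show ?thesis .
  qed
  have inj: "inj_on ?f (cells \<mu>)"
  proof (rule inj_onI, clarify)
    fix i j i' j'
    assume c: "(i, j) \<in> cells \<mu>" "(i', j') \<in> cells \<mu>" and eq: "canon_tableau \<mu> i j = canon_tableau \<mu> i' j'"
    have "i = i'"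
    proof (rule ccontr)
      assume "i \<noteq> i'"
      then consider "i < i'" | "i' < i" by linarith
      then show False
        using next_row[of i i' j] next_row[of i' i j'] c eq
        by cases (auto simp: cells_def canon_tableau_def)
    qed
    then show "i = i' \<and> j = j'" using eq by (simp add: canon_tableau_def)
  qed
  have "?f ` cells \<mu> \<subseteq> {1..sum_list \<mu>}"
  proof clarify
    fix i j assume "(i, j) \<in> cells \<mu>"
    then show "canon_tableau \<mu> i j \<in> {1..sum_list \<mu>}"
      using next_row[of i "length \<mu>" j] by (auto simp: cells_def canon_tableau_def)
  qed
  moreover have "card (?f ` cells \<mu>) = card {1..sum_list \<mu>}"
    using inj by (simp add: card_image) (simp add: cells_def sum_list_sum_nth atLeast0LessThan)
  ultimately show ?thesis
    using inj by (simp add: bij_betw_def card_subset_eq)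
qed

text \<open>Outside \<open>{1..sum_list \<mu>}\<close> the value is arbitrary but fixed, and every permutation of the boxes
  leaves it in place; equalities of words can therefore be stated for total functions.\<close>

definition box_row :: "nat list \<Rightarrow> nat \<Rightarrow> nat"
  where "box_row \<mu> t = fst (inv_into (cells \<mu>) (\<lambda>(i, j). canon_tableau \<mu> i j) t)"

definition box_col :: "nat list \<Rightarrow> nat \<Rightarrow> nat"
  where "box_col \<mu> t = snd (inv_into (cells \<mu>) (\<lambda>(i, j). canon_tableau \<mu> i j) t)"

lemma box_canon_tableau:
  assumes "i < length \<mu>" "j < \<mu> ! i"
  shows "box_row \<mu> (canon_tableau \<mu> i j) = i" "box_col \<mu> (canon_tableau \<mu> i j) = j"
    "canon_tableau \<mu> i j \<in> {1..sum_list \<mu>}"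
  using assms bij_betw_inv_into_left[OF canon_tableau_bij[of \<mu>], of "(i, j)"]
    bij_betwE[OF canon_tableau_bij[of \<mu>]]
  by (auto simp: cells_def box_row_def box_col_def)

lemma canon_tableau_box:
  assumes "t \<in> {1..sum_list \<mu>}"
  shows "box_row \<mu> t < length \<mu>" "box_col \<mu> t < \<mu> ! box_row \<mu> t"
    "canon_tableau \<mu> (box_row \<mu> t) (box_col \<mu> t) = t"
proof -
  have "t \<in> (\<lambda>(i, j). canon_tableau \<mu> i j) ` cells \<mu>"
    using assms bij_betw_imp_surj_on[OF canon_tableau_bij[of \<mu>]] by simp
  then obtain i j where "i < length \<mu>" "j < \<mu> ! i" "t = canon_tableau \<mu> i j"
    by (auto simp: cells_def)
  then show "box_row \<mu> t < length \<mu>" "box_col \<mu> t < \<mu> ! box_row \<mu> t"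
    "canon_tableau \<mu> (box_row \<mu> t) (box_col \<mu> t) = t"
    by (simp_all add: box_canon_tableau)
qed

lemma box_inj: "inj_on (\<lambda>t. (box_row \<mu> t, box_col \<mu> t)) {1..sum_list \<mu>}"
  by (rule inj_onI) (metis canon_tableau_box(3) prod.inject)

lemma box_eqI:
  assumes "s \<in> {1..sum_list \<mu>}" "t \<in> {1..sum_list \<mu>}" "box_row \<mu> s = box_row \<mu> t" "box_col \<mu> s = box_col \<mu> t"
  shows "s = t"
  using assms canon_tableau_box(3) by metis

lemma tableau_row_eq: "i < length \<mu> \<Longrightarrow> tableau_row \<mu> i = {t \<in> {1..sum_list \<mu>}. box_row \<mu> t = i}"
proof (intro equalityI subsetI)
  fix t assume "i < length \<mu>" "t \<in> {t \<in> {1..sum_list \<mu>}. box_row \<mu> t = i}"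
  then show "t \<in> tableau_row \<mu> i"
    using canon_tableau_box[of t \<mu>] by (auto simp: tableau_row_def intro!: exI[of _ "box_col \<mu> t"])
qed (use box_canon_tableau[of i \<mu>] in \<open>auto simp: tableau_row_def\<close>)

lemma tableau_col_eq: "tableau_col \<mu> j = {t \<in> {1..sum_list \<mu>}. box_col \<mu> t = j}"
proof (intro equalityI subsetI)
  fix t assume "t \<in> {t \<in> {1..sum_list \<mu>}. box_col \<mu> t = j}"
  then show "t \<in> tableau_col \<mu> j"
    using canon_tableau_box[of t \<mu>] by (auto simp: tableau_col_def intro!: exI[of _ "box_row \<mu> t"])
qed (use box_canon_tableau[of _ \<mu> j] in \<open>auto simp: tableau_col_def\<close>)

lemma card_box_row: "card {t \<in> {1..sum_list \<mu>}. box_row \<mu> t = i} = (if i < length \<mu> then \<mu> ! i else 0)"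
proof (cases "i < length \<mu>")
  case True
  have "tableau_row \<mu> i = canon_tableau \<mu> i ` {..<\<mu> ! i}"
    by (auto simp: tableau_row_def)
  moreover have "inj_on (canon_tableau \<mu> i) {..<\<mu> ! i}"
    by (auto simp: inj_on_def canon_tableau_def)
  ultimately have "card (tableau_row \<mu> i) = \<mu> ! i"
    by (simp add: card_image)
  with True show ?thesis by (simp add: tableau_row_eq)
next
  case False
  then have "{t \<in> {1..sum_list \<mu>}. box_row \<mu> t = i} = {}"
    using canon_tableau_box(1) by blast
  with False show ?thesis by (simp only: card.empty if_False)
qed

text \<open>An injective map of a finite block into itself is onto, so preserving the letter at each position
  already maps every block onto itself.\<close>

lemma word_stabilizer_eq_block_preserving:
  assumes "\<And>t. t \<in> {1..n} \<Longrightarrow> w t \<in> I"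
  shows "word_stabilizer n w =
    {p \<in> carrier (sym_group n). \<forall>i\<in>I. p ` {t \<in> {1..n}. w t = i} = {t \<in> {1..n}. w t = i}}"
proof (intro equalityI subsetI)
  fix p assume p: "p \<in> word_stabilizer n w"
  then have perm: "p permutes {1..n}" and wp: "w (p t) = w t" for t
    by (auto simp: word_stabilizer_def fun_eq_iff)
  have "p ` {t \<in> {1..n}. w t = i} = {t \<in> {1..n}. w t = i}" for i
    by (rule endo_inj_surj) (use perm wp permutes_in_image[OF perm] permutes_inj_on[OF perm] in auto)
  with perm show "p \<in> {p \<in> carrier (sym_group n). \<forall>i\<in>I. p ` {t \<in> {1..n}. w t = i} = {t \<in> {1..n}. w t = i}}"
    by (simp add: sym_group_carrier)
next
  fix p assume p: "p \<in> {p \<in> carrier (sym_group n). \<forall>i\<in>I. p ` {t \<in> {1..n}. w t = i} = {t \<in> {1..n}. w t = i}}"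
  then have perm: "p permutes {1..n}" by (simp add: sym_group_carrier)
  have "w (p t) = w t" for t
  proof (cases "t \<in> {1..n}")
    case True
    then have "p t \<in> p ` {t' \<in> {1..n}. w t' = w t}" by simp
    also have "\<dots> = {t' \<in> {1..n}. w t' = w t}" using p assms[OF True] by blast
    finally show ?thesis by simp
  next
    case False
    then show ?thesis using perm by (simp add: permutes_not_in)
  qed
  with perm show "p \<in> word_stabilizer n w" by (auto simp: word_stabilizer_def)
qed

lemma young_subgroup_eq: "young_subgroup \<mu> = word_stabilizer (sum_list \<mu>) (box_row \<mu>)"
  by (subst word_stabilizer_eq_block_preserving[where I = "{..<length \<mu>}"])
    (simp_all add: canon_tableau_box(1) young_subgroup_def tableau_row_eq Ball_def)

lemma column_subgroup_eq: "column_subgroup \<mu> = word_stabilizer (sum_list \<mu>) (box_col \<mu>)"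
  by (subst word_stabilizer_eq_block_preserving[where I = UNIV])
    (simp_all add: column_subgroup_def tableau_col_eq)

text \<open>Specialized to the row word of \<open>\<mu>\<close>: the permutation module of \<open>\<mu>\<close> is the module of words
  with \<open>\<mu> ! i\<close> letters \<open>i\<close>.\<close>

lemma perm_char_eq_card_fixed:
  assumes "g permutes {1..sum_list \<mu>}"
  shows "perm_char \<mu> g = of_nat (card {u \<in> rearrangements (sum_list \<mu>) (box_row \<mu>). u \<circ> g = u})"
  using induced_trivial_char_eq_card_fixed[OF assms] by (simp add: perm_char_def young_subgroup_eq)

section \<open>The Young symmetrizer\<close>

text \<open>Both the row symmetrizer and the column antisymmetrizer are sums over a subgroup weighted by a
  one-dimensional character, hence idempotent up to the order of the subgroup.\<close>

lemma (in group) subgroup_character_square: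
  assumes fin: "finite (carrier G)" and H: "subgroup H G"
    and s: "\<And>x z. x \<in> H \<Longrightarrow> z \<in> H \<Longrightarrow> s (x \<otimes> inv z) * s z = s x"
  shows "ga_mult G (\<lambda>p. if p \<in> H then s p else 0) (\<lambda>p. if p \<in> H then s p else 0) =
    fun_scale (of_nat (card H)) (\<lambda>p. if p \<in> H then s p else 0)"
proof
  fix x
  let ?f = "\<lambda>p. if p \<in> H then s p else 0"
  have HG: "H \<subseteq> carrier G" using H by (rule subgroup.subset)
  show "ga_mult G ?f ?f x = fun_scale (of_nat (card H)) ?f x"
  proof (cases "x \<in> carrier G")
    case True
    have "ga_mult G ?f ?f x = (\<Sum>z\<in>carrier G. ?f (x \<otimes> inv z) * ?f z)"
      using True by (rule ga_mult_at)
    also have "\<dots> = (\<Sum>z\<in>H. ?f (x \<otimes> inv z) * s z)"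
      using fin HG by (intro sum.mono_neutral_cong_right) auto
    also have "\<dots> = (\<Sum>z\<in>H. ?f x)"
    proof (rule sum.cong[OF refl])
      fix z assume z: "z \<in> H"
      then have zG: "z \<in> carrier G" using HG by blast
      have "x \<otimes> inv z \<in> H \<longleftrightarrow> x \<in> H"
      proof
        assume "x \<otimes> inv z \<in> H"
        then have "x \<otimes> inv z \<otimes> z \<in> H" using z H by (simp add: subgroup.m_closed)
        then show "x \<in> H" using True zG by (simp add: m_assoc)
      qed (use z H in \<open>simp add: subgroup.m_closed subgroup.m_inv_closed\<close>)
      then show "?f (x \<otimes> inv z) * s z = ?f x" using s z by simp
    qed
    finally show ?thesis by (simp add: fun_scale_def)
  next
    case False
    then show ?thesis using HG by (auto simp: ga_mult_outside fun_scale_def)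
  qed
qed

lemma sign_permutes_comp:
  assumes "p permutes {1..n::nat}" "q permutes {1..n}"
  shows "sign (p \<circ> q) = sign p * sign q" "sign (inv' p) = sign p"
  using assms by (auto intro!: sign_compose sign_inverse simp: permutation_permutes)

text \<open>A box is determined by its row and column; so the row group and the column group intersect
  trivially, and products \<open>p \<circ> q\<close> of their elements are pairwise distinct.\<close>

lemma permutes_eq_if_box_eq:
  assumes "p permutes {1..sum_list \<mu>}" "q permutes {1..sum_list \<mu>}"
    and "box_row \<mu> \<circ> p = box_row \<mu> \<circ> q" "box_col \<mu> \<circ> p = box_col \<mu> \<circ> q"
  shows "p = q"
proof
  fix t
  show "p t = q t"
  proof (cases "t \<in> {1..sum_list \<mu>}")
    case True
    then have "p t \<in> {1..sum_list \<mu>}" "q t \<in> {1..sum_list \<mu>}"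
      using assms(1,2) by (simp_all only: permutes_in_image)
    moreover have "box_row \<mu> (p t) = box_row \<mu> (q t)" "box_col \<mu> (p t) = box_col \<mu> (q t)"
      using fun_cong[OF assms(3), of t] fun_cong[OF assms(4), of t] by simp_all
    ultimately show ?thesis by (rule box_eqI)
  next
    case False
    then show ?thesis using assms(1,2) by (simp add: permutes_not_in)
  qed
qed

text \<open>For a given \<open>q\<close>, the permutation \<open>g\<close> is \<open>p \<circ> q\<close> for some \<open>p\<close> in the row group exactly when \<open>g\<close> and
  \<open>q\<close> send the row word to the same word.\<close>

lemma young_symmetrizer_eq_sum:
  assumes g: "g permutes {1..sum_list \<mu>}"
  shows "young_symmetrizer \<mu> g =
    (\<Sum>q\<in>column_subgroup \<mu>. of_int (sign q) * (if box_row \<mu> \<circ> g = box_row \<mu> \<circ> q then 1 else 0))"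
proof -
  let ?G = "sym_group (sum_list \<mu>)"
  interpret group ?G by (rule sym_group_is_group)
  have row: "row_symmetrizer \<mu> (g \<otimes>\<^bsub>?G\<^esub> inv' q) = (if box_row \<mu> \<circ> g = box_row \<mu> \<circ> q then 1 else 0)"
    if q: "q permutes {1..sum_list \<mu>}" for q
    using comp_eq_comp_permutes[OF permutes_inv[OF q], of "box_row \<mu> \<circ> g" "box_row \<mu>"] q g
    by (simp add: row_symmetrizer_def young_subgroup_eq word_stabilizer_def sym_group_carrier sym_group_mult
        permutes_compose permutes_inv permutes_inv_inv comp_assoc)
  have "young_symmetrizer \<mu> g = (\<Sum>q\<in>carrier ?G.
      row_symmetrizer \<mu> (g \<otimes>\<^bsub>?G\<^esub> inv\<^bsub>?G\<^esub> q) * column_antisymmetrizer \<mu> q)"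
    unfolding young_symmetrizer_def using g by (intro ga_mult_at) (simp add: sym_group_carrier)
  also have "\<dots> = (\<Sum>q\<in>column_subgroup \<mu>.
      of_int (sign q) * (if box_row \<mu> \<circ> g = box_row \<mu> \<circ> q then 1 else 0))"
    using finite_sym_group[of "sum_list \<mu>"]
    by (intro sum.mono_neutral_cong_right)
      (auto simp: column_antisymmetrizer_def column_subgroup_def row sym_group_carrier)
  finally show ?thesis .
qed

lemma young_symmetrizer_id: "young_symmetrizer \<mu> id = 1"
proof -
  have id: "id \<in> column_subgroup \<mu>"
    by (simp add: column_subgroup_eq word_stabilizer_def permutes_id)
  have "young_symmetrizer \<mu> id = (\<Sum>q\<in>column_subgroup \<mu>. if q = id then 1 else 0)"
    unfolding young_symmetrizer_eq_sum[OF permutes_id]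
  proof (rule sum.cong[OF refl])
    fix q assume "q \<in> column_subgroup \<mu>"
    then have "box_row \<mu> \<circ> id = box_row \<mu> \<circ> q \<Longrightarrow> q = id"
      using permutes_eq_if_box_eq[of q \<mu> id]
      by (simp add: column_subgroup_eq word_stabilizer_def permutes_id)
    then show "of_int (sign q) * (if box_row \<mu> \<circ> id = box_row \<mu> \<circ> q then 1 else 0) =
        (if q = id then 1 else 0 :: complex)"
      by auto
  qed
  with id show ?thesis
    by (simp add: column_subgroup_eq finite_word_stabilizer)
qed

lemma young_symmetrizer_Reals: "young_symmetrizer \<mu> g \<in> \<real>"
proof -
  interpret group "sym_group (sum_list \<mu>)" by (rule sym_group_is_group)
  show ?thesis
    unfolding young_symmetrizer_def
    by (rule ga_mult_Reals) (auto simp: row_symmetrizer_def column_antisymmetrizer_def)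
qed

lemma sum_times_young_symmetrizer:
  "(\<Sum>g\<in>carrier (sym_group (sum_list \<mu>)). F g * young_symmetrizer \<mu> g) =
    (\<Sum>p\<in>young_subgroup \<mu>. \<Sum>q\<in>column_subgroup \<mu>. of_int (sign q) * F (p \<circ> q))"
proof -
  let ?G = "sym_group (sum_list \<mu>)"
  interpret group ?G by (rule sym_group_is_group)
  have "(\<Sum>g\<in>carrier ?G. F g * young_symmetrizer \<mu> g) =
      (\<Sum>p\<in>carrier ?G. \<Sum>q\<in>carrier ?G. row_symmetrizer \<mu> p * column_antisymmetrizer \<mu> q * F (p \<circ> q))"
    unfolding young_symmetrizer_def sum_times_ga_mult sym_group_mult ..
  also have "\<dots> = (\<Sum>p\<in>young_subgroup \<mu>. \<Sum>q\<in>carrier ?G. column_antisymmetrizer \<mu> q * F (p \<circ> q))"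
    using finite_sym_group
    by (intro sum.mono_neutral_cong_right) (auto simp: row_symmetrizer_def young_subgroup_def)
  also have "\<dots> = (\<Sum>p\<in>young_subgroup \<mu>. \<Sum>q\<in>column_subgroup \<mu>. of_int (sign q) * F (p \<circ> q))"
    using finite_sym_group
    by (intro sum.cong refl sum.mono_neutral_cong_right)
      (auto simp: column_antisymmetrizer_def column_subgroup_def)
  finally show ?thesis .
qed

lemma row_symmetrizer_translate:
  assumes "p \<in> young_subgroup \<mu>" "g permutes {1..sum_list \<mu>}"
  shows "row_symmetrizer \<mu> (p \<circ> g) = row_symmetrizer \<mu> g"
proof -
  have "p permutes {1..sum_list \<mu>}" "box_row \<mu> \<circ> p = box_row \<mu>"
    using assms(1) by (simp_all add: young_subgroup_eq word_stabilizer_def)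
  then show ?thesis
    using assms(2) by (simp add: row_symmetrizer_def young_subgroup_eq word_stabilizer_def permutes_compose
        flip: comp_assoc)
qed

lemma column_antisymmetrizer_translate:
  assumes "q \<in> column_subgroup \<mu>" "g permutes {1..sum_list \<mu>}"
  shows "column_antisymmetrizer \<mu> (g \<circ> q) = of_int (sign q) * column_antisymmetrizer \<mu> g"
proof -
  have q: "q permutes {1..sum_list \<mu>}" "box_col \<mu> \<circ> q = box_col \<mu>"
    using assms(1) by (simp_all add: column_subgroup_eq word_stabilizer_def)
  have "box_col \<mu> \<circ> (g \<circ> q) = box_col \<mu> \<longleftrightarrow> box_col \<mu> \<circ> g = box_col \<mu>"
    using comp_eq_comp_permutes[OF q(1)] q(2) by (metis comp_assoc)
  then show ?thesis
    using assms(2) q sign_permutes_comp(1)[OF assms(2) q(1)]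
    by (simp add: column_antisymmetrizer_def column_subgroup_eq word_stabilizer_def permutes_compose)
qed

text \<open>Von Neumann's criterion: the Young symmetrizer and its square have this property, and it determines
  a function on the symmetric group up to a scalar.\<close>

definition young_equivariant :: "nat list \<Rightarrow> ((nat \<Rightarrow> nat) \<Rightarrow> complex) \<Rightarrow> bool"
  where "young_equivariant \<mu> f \<longleftrightarrow>
    (\<forall>p\<in>young_subgroup \<mu>. \<forall>q\<in>column_subgroup \<mu>. \<forall>g. g permutes {1..sum_list \<mu>} \<longrightarrow>
      f (p \<circ> g) = f g \<and> f (g \<circ> q) = of_int (sign q) * f g)"

lemma young_equivariant_symmetrizer: "young_equivariant \<mu> (young_symmetrizer \<mu>)"
  and young_equivariant_symmetrizer_square:
  "young_equivariant \<mu> (ga_mult (sym_group (sum_list \<mu>)) (young_symmetrizer \<mu>) (young_symmetrizer \<mu>))"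
proof -
  let ?G = "sym_group (sum_list \<mu>)"
  interpret group ?G by (rule sym_group_is_group)
  have RC: "p \<in> carrier ?G" if "p \<in> young_subgroup \<mu> \<or> p \<in> column_subgroup \<mu>" for p
    using that by (auto simp: young_subgroup_def column_subgroup_def)
  have left: "ga_mult ?G f h (p \<circ> g) = ga_mult ?G f h g"
    if "p \<in> young_subgroup \<mu>" "g permutes {1..sum_list \<mu>}"
      "\<And>y. y permutes {1..sum_list \<mu>} \<Longrightarrow> f (p \<circ> y) = f y" for f h p g
    using ga_mult_equivariant_left[of p g f 1 h] that RC by (simp add: sym_group_carrier sym_group_mult)
  have right: "ga_mult ?G f h (g \<circ> q) = of_int (sign q) * ga_mult ?G f h g"
    if "q \<in> column_subgroup \<mu>" "g permutes {1..sum_list \<mu>}"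
      "\<And>y. y permutes {1..sum_list \<mu>} \<Longrightarrow> h (y \<circ> q) = of_int (sign q) * h y" for f h q g
    using ga_mult_equivariant_right[of q g h "of_int (sign q)" f] that RC
    by (simp add: sym_group_carrier sym_group_mult)
  show c: "young_equivariant \<mu> (young_symmetrizer \<mu>)"
    unfolding young_equivariant_def young_symmetrizer_def
    by (intro ballI allI impI conjI left right row_symmetrizer_translate column_antisymmetrizer_translate)
  show "young_equivariant \<mu> (ga_mult ?G (young_symmetrizer \<mu>) (young_symmetrizer \<mu>))"
    unfolding young_equivariant_def
    by (intro ballI allI impI conjI left right) (use c in \<open>auto simp: young_equivariant_def\<close>)
qed

text \<open>The exchange argument of \<open>column_rearrangement\<close> for the row word itself: weighting row \<open>i\<close> by its
  length \<open>\<mu> ! i\<close> makes the rows that meet a column heavier than the rows that miss it.\<close>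

lemma column_distinct_imp_column_word:
  assumes g: "g permutes {1..sum_list \<mu>}"
    and inj: "inj_on (\<lambda>t. (box_row \<mu> (g t), box_col \<mu> t)) {1..sum_list \<mu>}"
  shows "\<exists>q\<in>column_subgroup \<mu>. box_row \<mu> \<circ> g = box_row \<mu> \<circ> q"
  unfolding column_subgroup_eq
proof (rule column_rearrangement[where z = "\<lambda>i. real (\<mu> ! i)"])
  show "inj_on (\<lambda>t. ((box_row \<mu> \<circ> g) t, box_col \<mu> t)) {1..sum_list \<mu>}"
    using inj by simp
  show "inj_on (\<lambda>t. (box_row \<mu> t, box_col \<mu> t)) {1..sum_list \<mu>}"
    by (rule box_inj)
  show "(box_row \<mu> \<circ> g) t = box_row \<mu> t" if "t \<notin> {1..sum_list \<mu>}" for t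
    using permutes_not_in[OF g that] by simp
  show "(\<Sum>t\<in>{1..sum_list \<mu>}. real (\<mu> ! (box_row \<mu> \<circ> g) t)) =
      (\<Sum>t\<in>{1..sum_list \<mu>}. real (\<mu> ! box_row \<mu> t))"
    using sum.permute[OF g, of "\<lambda>t. real (\<mu> ! box_row \<mu> t)"] by (simp add: o_def)
  fix s t
  assume s: "s \<in> {1..sum_list \<mu>}" and t: "t \<in> {1..sum_list \<mu>}"
    and absent: "\<And>t'. t' \<in> {1..sum_list \<mu>} \<Longrightarrow> box_col \<mu> t' = box_col \<mu> s \<Longrightarrow>
      box_row \<mu> t' \<noteq> (box_row \<mu> \<circ> g) t"
  have "box_row \<mu> (g t) < length \<mu>"
    using canon_tableau_box(1) permutes_in_image[OF g] t by blast
  then have "\<mu> ! box_row \<mu> (g t) \<le> box_col \<mu> s"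
    using absent[of "canon_tableau \<mu> (box_row \<mu> (g t)) (box_col \<mu> s)"]
      box_canon_tableau[of "box_row \<mu> (g t)" \<mu> "box_col \<mu> s"] by fastforce
  also have "\<dots> < \<mu> ! box_row \<mu> s"
    using canon_tableau_box(2)[OF s] .
  finally show "real (\<mu> ! (box_row \<mu> \<circ> g) t) < real (\<mu> ! box_row \<mu> s)"
    by simp
qed

text \<open>Two boxes \<open>s\<close> and \<open>t\<close> of one column that \<open>g\<close> sends to the same row give a column transposition and a row
  transposition with the same effect on \<open>g\<close>; the first changes the sign of the value and the
  second does not.\<close>

lemma young_equivariant_zero:
  assumes f: "young_equivariant \<mu> f" and g: "g permutes {1..sum_list \<mu>}"
    and notinj: "\<not> inj_on (\<lambda>t. (box_row \<mu> (g t), box_col \<mu> t)) {1..sum_list \<mu>}"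
  shows "f g = 0"
proof -
  obtain s t where st: "s \<in> {1..sum_list \<mu>}" "t \<in> {1..sum_list \<mu>}" "s \<noteq> t"
    "box_row \<mu> (g s) = box_row \<mu> (g t)" "box_col \<mu> s = box_col \<mu> t"
    using notinj by (auto simp: inj_on_def)
  have swap: "w \<circ> transpose a b = w" if "w a = w b" for w :: "nat \<Rightarrow> nat" and a b
    using that by (auto simp: fun_eq_iff transpose_def)
  have "transpose s t \<in> column_subgroup \<mu>"
    using st swap[of "box_col \<mu>" s t]
    by (simp add: column_subgroup_eq word_stabilizer_def permutes_swap_id)
  moreover have "transpose (g s) (g t) \<in> young_subgroup \<mu>"
    using st swap[of "box_row \<mu>" "g s" "g t"] permutes_in_image[OF g]
    by (simp add: young_subgroup_eq word_stabilizer_def permutes_swap_id)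
  moreover have "transpose (g s) (g t) \<circ> g = g \<circ> transpose s t"
    using permutes_inj[OF g] by (auto simp: fun_eq_iff transpose_def inj_eq)
  ultimately have "f g = - f g"
    using f g st(3) unfolding young_equivariant_def by (metis mult_minus1 of_int_1 of_int_minus sign_swap_id)
  then show ?thesis by simp
qed

text \<open>By the two preceding lemmas, \<open>f\<close> vanishes at \<open>g\<close> unless \<open>g\<close> is a product of a row
  permutation and a column permutation, and there its value is \<open>f id\<close> up to the sign.\<close>

lemma young_equivariant_eq_scalar_multiple:
  assumes f: "young_equivariant \<mu> f" and g: "g permutes {1..sum_list \<mu>}"
  shows "f g = f id * young_symmetrizer \<mu> g"
proof (cases "inj_on (\<lambda>t. (box_row \<mu> (g t), box_col \<mu> t)) {1..sum_list \<mu>}")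
  case True
  then obtain q where q: "q \<in> column_subgroup \<mu>" "box_row \<mu> \<circ> g = box_row \<mu> \<circ> q"
    using column_distinct_imp_column_word[OF g] by blast
  then have qp: "q permutes {1..sum_list \<mu>}"
    by (simp add: column_subgroup_eq word_stabilizer_def)
  have p: "g \<circ> inv' q \<in> young_subgroup \<mu>"
    using q(2) comp_permutes_inv(3)[OF qp, of "box_row \<mu>"] permutes_compose[OF permutes_inv[OF qp] g]
    by (simp add: young_subgroup_eq word_stabilizer_def flip: comp_assoc)
  have eval: "h g = of_int (sign q) * h id" if "young_equivariant \<mu> h" for h
  proof -
    have "h g = h ((g \<circ> inv' q) \<circ> (id \<circ> q))"
      using comp_permutes_inv(4)[OF qp, of g] by simp
    also have "\<dots> = h (id \<circ> q)"
      using that p q(1) qp unfolding young_equivariant_def by simp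
    also have "\<dots> = of_int (sign q) * h id"
      using that p q(1) permutes_id unfolding young_equivariant_def by blast
    finally show ?thesis .
  qed
  show ?thesis
    using eval[OF f] eval[OF young_equivariant_symmetrizer] by (simp add: young_symmetrizer_id)
next
  case False
  then show ?thesis
    using young_equivariant_zero[OF f g False] young_equivariant_zero[OF young_equivariant_symmetrizer g False]
    by simp
qed

lemma young_symmetrizer_quasi_idempotent:
  fixes \<mu> :: "nat list"
  defines "G \<equiv> sym_group (sum_list \<mu>)" and "c \<equiv> young_symmetrizer \<mu>"
  shows "ga_mult G c c = fun_scale (ga_mult G c c id) c"
proof
  fix g
  show "ga_mult G c c g = fun_scale (ga_mult G c c id) c g"
  proof (cases "g \<in> carrier G")
    case True
    then show ?thesis
      unfolding G_def c_def fun_scale_def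
      by (intro young_equivariant_eq_scalar_multiple young_equivariant_symmetrizer_square)
        (simp add: sym_group_carrier)
  next
    case False
    then show ?thesis
      by (simp add: G_def c_def fun_scale_def young_symmetrizer_def ga_mult_outside)
  qed
qed

lemma young_symmetrizer_scalar_nonzero:
  fixes \<mu> :: "nat list"
  defines "G \<equiv> sym_group (sum_list \<mu>)" and "c \<equiv> young_symmetrizer \<mu>"
  shows "ga_mult G c c id \<noteq> 0"
proof -
  interpret group G unfolding G_def by (rule sym_group_is_group)
  have R: "subgroup (young_subgroup \<mu>) G" and C: "subgroup (column_subgroup \<mu>) G"
    by (simp_all add: G_def young_subgroup_eq column_subgroup_eq word_stabilizer_subgroup)
  have fin: "finite (carrier G)" by (simp add: G_def finite_sym_group)
  have perm: "p permutes {1..sum_list \<mu>}" if "p \<in> column_subgroup \<mu>" for p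
    using that by (simp add: column_subgroup_eq word_stabilizer_def)
  have inv_iff: "inv\<^bsub>G\<^esub> x \<in> H \<longleftrightarrow> x \<in> H" if "subgroup H G" "x \<in> carrier G" for H x
    using that subgroup.m_inv_closed[OF that(1)] by fastforce
  have sgn: "sign (x \<otimes>\<^bsub>G\<^esub> inv\<^bsub>G\<^esub> z) * sign z = sign x" if "x \<in> column_subgroup \<mu>" "z \<in> column_subgroup \<mu>" for x z
    using perm[OF that(1)] perm[OF that(2)]
    by (simp add: G_def sym_group_mult sym_group_carrier sign_permutes_comp permutes_inv mult.assoc)
  have "ga_mult G (row_symmetrizer \<mu>) (row_symmetrizer \<mu>) =
      fun_scale (of_nat (card (young_subgroup \<mu>))) (row_symmetrizer \<mu>)"
    unfolding row_symmetrizer_def by (rule subgroup_character_square[OF fin R]) simp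
  moreover have "ga_mult G (column_antisymmetrizer \<mu>) (column_antisymmetrizer \<mu>) =
      fun_scale (of_nat (card (column_subgroup \<mu>))) (column_antisymmetrizer \<mu>)"
    unfolding column_antisymmetrizer_def
    by (rule subgroup_character_square[OF fin C]) (simp add: sgn flip: of_int_mult)
  moreover have "ga_mult G (row_symmetrizer \<mu>) (column_antisymmetrizer \<mu>) \<noteq> 0"
    using young_symmetrizer_id[of \<mu>] by (auto simp: young_symmetrizer_def G_def)
  moreover have "row_symmetrizer \<mu> (inv\<^bsub>G\<^esub> x) = row_symmetrizer \<mu> x" if "x \<in> carrier G" for x
    using inv_iff[OF R that] by (simp add: row_symmetrizer_def)
  moreover have "column_antisymmetrizer \<mu> (inv\<^bsub>G\<^esub> x) = column_antisymmetrizer \<mu> x" if "x \<in> carrier G" for x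
    using inv_iff[OF C that] that
    by (simp add: column_antisymmetrizer_def G_def sym_group_carrier sign_permutes_comp)
  ultimately have "ga_mult G c c \<noteq> 0"
    unfolding c_def young_symmetrizer_def G_def[symmetric]
    by (intro ga_square_nonzero[OF fin]) (auto simp: row_symmetrizer_def column_antisymmetrizer_def)
  then show ?thesis
    using young_symmetrizer_quasi_idempotent[of \<mu>]
    by (auto simp: G_def c_def fun_scale_def zero_fun_def)
qed

text \<open>After moving the row permutation \<open>p\<close> to the right-hand side, the words with a repeated letter in some column
  cancel by \<open>sum_sign_cancels\<close>. The remaining ones are \<open>u0 \<circ> q\<close> with \<open>q\<close> a column permutation, and
  they reproduce the expansion of the square of the Young symmetrizer at the identity.\<close>

lemma sum_fixed_words_young_symmetrizer:
  fixes X :: "(nat \<Rightarrow> 'l) set" and \<mu> :: "nat list"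
  defines "G \<equiv> sym_group (sum_list \<mu>)" and "c \<equiv> young_symmetrizer \<mu>"
  assumes finX: "finite X"
    and closed: "\<And>w p. w \<in> X \<Longrightarrow> p permutes {1..sum_list \<mu>} \<Longrightarrow> w \<circ> p \<in> X"
    and u0: "u0 \<in> X"
    and rows: "\<And>p q. p permutes {1..sum_list \<mu>} \<Longrightarrow> q permutes {1..sum_list \<mu>} \<Longrightarrow>
      u0 \<circ> p = u0 \<circ> q \<longleftrightarrow> box_row \<mu> \<circ> p = box_row \<mu> \<circ> q"
    and distinct: "\<And>u. u \<in> X \<Longrightarrow> inj_on (\<lambda>t. (u t, box_col \<mu> t)) {1..sum_list \<mu>} \<Longrightarrow>
      \<exists>q\<in>column_subgroup \<mu>. u = u0 \<circ> q"
  shows "(\<Sum>g\<in>carrier G. of_nat (card {w \<in> X. w \<circ> g = w}) * c g) = ga_mult G c c id"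
proof -
  interpret group G unfolding G_def by (rule sym_group_is_group)
  let ?R = "young_subgroup \<mu>" and ?C = "column_subgroup \<mu>"
  let ?sg = "\<lambda>q. of_int (sign q) :: complex"
  have perm: "p permutes {1..sum_list \<mu>}" if "p \<in> ?R \<or> p \<in> ?C" for p
    using that by (auto simp: young_subgroup_eq column_subgroup_eq word_stabilizer_def)
  have C: "subgroup ?C G"
    by (simp add: G_def column_subgroup_eq word_stabilizer_subgroup)
  have u0_inj: "inj_on (\<lambda>q. u0 \<circ> q) ?C"
  proof (rule inj_onI)
    fix p q assume pq: "p \<in> ?C" "q \<in> ?C" "u0 \<circ> p = u0 \<circ> q"
    then have "p permutes {1..sum_list \<mu>}" "q permutes {1..sum_list \<mu>}"
      using perm by blast+
    moreover from this have "box_row \<mu> \<circ> p = box_row \<mu> \<circ> q"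
      using rows pq(3) by blast
    moreover have "box_col \<mu> \<circ> p = box_col \<mu> \<circ> q"
      using pq(1,2) by (simp add: column_subgroup_eq word_stabilizer_def)
    ultimately show "p = q" by (rule permutes_eq_if_box_eq)
  qed
  have signed_count: "(\<Sum>q\<in>?C. ?sg q * of_nat (card {w \<in> X. w \<circ> (p \<circ> q) = w})) =
      (\<Sum>q\<in>?C. ?sg q * c (q \<circ> inv' p))" if p: "p \<in> ?R" for p
  proof -
    have pp: "p permutes {1..sum_list \<mu>}" using perm p by blast
    have pi: "inv' p permutes {1..sum_list \<mu>}" using pp by (rule permutes_inv)
    define S where "S u = (\<Sum>q\<in>?C. ?sg q * (if u \<circ> q = u \<circ> inv' p then 1 else 0))" for u :: "nat \<Rightarrow> 'l"
    \<comment> \<open>substitute \<open>u = w \<circ> p\<close>\<close>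
    have count: "of_nat (card {w \<in> X. w \<circ> (p \<circ> q) = w}) =
        (\<Sum>u\<in>X. if u \<circ> q = u \<circ> inv' p then 1 else 0 :: complex)" for q
    proof -
      have "of_nat (card {w \<in> X. w \<circ> (p \<circ> q) = w}) = (\<Sum>w\<in>X. if w \<circ> (p \<circ> q) = w then 1 else 0 :: complex)"
        using finX by (simp add: sum.If_cases Int_def)
      also have "\<dots> = (\<Sum>u\<in>X. if u \<circ> q = u \<circ> inv' p then 1 else 0)"
        by (rule sum.reindex_bij_witness[where i = "\<lambda>u. u \<circ> inv' p" and j = "\<lambda>w. w \<circ> p"])
          (use closed pp pi comp_permutes_inv[OF pp] in \<open>auto simp: comp_assoc\<close>)
      finally show ?thesis .
    qed
    have "(\<Sum>q\<in>?C. ?sg q * of_nat (card {w \<in> X. w \<circ> (p \<circ> q) = w})) = (\<Sum>u\<in>X. S u)"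
      unfolding count S_def sum_distrib_left by (rule sum.swap)
    also have "\<dots> = (\<Sum>u\<in>(\<lambda>q. u0 \<circ> q) ` ?C. S u)"
    proof (rule sum.mono_neutral_right[OF finX])
      show "(\<lambda>q. u0 \<circ> q) ` ?C \<subseteq> X" using closed u0 perm by blast
      show "\<forall>u\<in>X - (\<lambda>q. u0 \<circ> q) ` ?C. S u = 0"
      proof
        fix u assume "u \<in> X - (\<lambda>q. u0 \<circ> q) ` ?C"
        then have "\<not> inj_on (\<lambda>t. (u t, box_col \<mu> t)) {1..sum_list \<mu>}"
          using distinct by blast
        then obtain s t where "s \<in> {1..sum_list \<mu>}" "t \<in> {1..sum_list \<mu>}" "s \<noteq> t"
          "u s = u t" "box_col \<mu> s = box_col \<mu> t"
          by (auto simp: inj_on_def)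
        then show "S u = 0"
          unfolding S_def column_subgroup_eq by (rule sum_sign_cancels)
      qed
    qed
    also have "\<dots> = (\<Sum>q\<in>?C. S (u0 \<circ> q))"
      using u0_inj by (simp add: sum.reindex)
    also have "\<dots> = (\<Sum>q\<in>?C. ?sg q * c (q \<circ> inv' p))"
    proof (rule sum.cong[OF refl])
      fix q assume q: "q \<in> ?C"
      have qp: "q permutes {1..sum_list \<mu>}" using perm q by blast
      let ?F = "\<lambda>r. ?sg q * ?sg r * (if box_row \<mu> \<circ> (q \<circ> inv' p) = box_row \<mu> \<circ> r then 1 else 0)"
      have "S (u0 \<circ> q) = (\<Sum>r\<in>?C. ?F (q \<otimes>\<^bsub>G\<^esub> r))"
        unfolding S_def
      proof (rule sum.cong[OF refl])
        fix r assume "r \<in> ?C"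
        then have rp: "r permutes {1..sum_list \<mu>}" using perm by blast
        have "u0 \<circ> q \<circ> r = u0 \<circ> q \<circ> inv' p \<longleftrightarrow> box_row \<mu> \<circ> (q \<circ> r) = box_row \<mu> \<circ> (q \<circ> inv' p)"
          using rows[OF permutes_compose[OF rp qp] permutes_compose[OF pi qp]] by (simp add: comp_assoc)
        moreover have "?sg q * ?sg (q \<circ> r) = ?sg r"
          using sign_permutes_comp(1)[OF qp rp] by (simp flip: of_int_mult)
        ultimately show "?sg r * (if u0 \<circ> q \<circ> r = u0 \<circ> q \<circ> inv' p then 1 else 0) = ?F (q \<otimes>\<^bsub>G\<^esub> r)"
          by (auto simp: G_def sym_group_mult)
      qed
      also have "\<dots> = (\<Sum>r\<in>?C. ?F r)"
        by (rule sum_subgroup_translate_left[OF C q])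
      also have "\<dots> = ?sg q * c (q \<circ> inv' p)"
        unfolding c_def young_symmetrizer_eq_sum[OF permutes_compose[OF pi qp]]
        by (simp add: sum_distrib_left mult.assoc)
      finally show "S (u0 \<circ> q) = ?sg q * c (q \<circ> inv' p)" .
    qed
    finally show ?thesis .
  qed
  have "(\<Sum>g\<in>carrier G. of_nat (card {w \<in> X. w \<circ> g = w}) * c g) =
      (\<Sum>p\<in>?R. \<Sum>q\<in>?C. ?sg q * c (q \<circ> inv' p))"
    unfolding G_def c_def sum_times_young_symmetrizer
    by (rule sum.cong[OF refl]) (rule signed_count[unfolded c_def])
  \<comment> \<open>replace \<open>q\<close> by its inverse, which has the same sign\<close>
  also have "\<dots> = (\<Sum>p\<in>?R. \<Sum>q\<in>?C. ?sg q * c (inv\<^bsub>G\<^esub> (p \<circ> q)))"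
  proof (rule sum.cong[OF refl])
    fix p assume p: "p \<in> ?R"
    have "(\<Sum>q\<in>?C. ?sg q * c (q \<circ> inv' p)) = (\<Sum>q\<in>?C. ?sg (inv\<^bsub>G\<^esub> q) * c (inv\<^bsub>G\<^esub> q \<circ> inv' p))"
      by (rule sum_subgroup_inverse[OF C, symmetric])
    also have "\<dots> = (\<Sum>q\<in>?C. ?sg q * c (inv\<^bsub>G\<^esub> (p \<circ> q)))"
    proof (rule sum.cong[OF refl])
      fix q assume q: "q \<in> ?C"
      have "p permutes {1..sum_list \<mu>}" "q permutes {1..sum_list \<mu>}" using perm p q by blast+
      then show "?sg (inv\<^bsub>G\<^esub> q) * c (inv\<^bsub>G\<^esub> q \<circ> inv' p) = ?sg q * c (inv\<^bsub>G\<^esub> (p \<circ> q))"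
        by (simp add: G_def sym_group_carrier permutes_compose sign_permutes_comp o_inv_distrib permutes_bij)
    qed
    finally show "(\<Sum>q\<in>?C. ?sg q * c (q \<circ> inv' p)) = (\<Sum>q\<in>?C. ?sg q * c (inv\<^bsub>G\<^esub> (p \<circ> q)))" .
  qed
  also have "\<dots> = (\<Sum>g\<in>carrier G. c (inv\<^bsub>G\<^esub> g) * c g)"
    unfolding G_def c_def sum_times_young_symmetrizer ..
  also have "\<dots> = ga_mult G c c id"
    using ga_mult_at_one[of c c] by (simp add: G_def sym_group_one mult.commute)
  finally show ?thesis .
qed

section \<open>Additive matrices\<close>

lemma sum_box_row:
  fixes h :: "nat \<Rightarrow> nat"
  shows "(\<Sum>t\<in>{1..sum_list \<mu>}. h (box_row \<mu> t)) = (\<Sum>s<length \<mu>. \<mu> ! s * h s)"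
proof -
  have "(\<Sum>t\<in>{1..sum_list \<mu>}. h (box_row \<mu> t)) =
      (\<Sum>s<length \<mu>. \<Sum>t\<in>{t \<in> {1..sum_list \<mu>}. box_row \<mu> t = s}. h (box_row \<mu> t))"
    using canon_tableau_box(1) by (intro sum.group[symmetric]) auto
  also have "\<dots> = (\<Sum>s<length \<mu>. \<mu> ! s * h s)"
  proof (rule sum.cong[OF refl])
    fix s assume "s \<in> {..<length \<mu>}"
    moreover have "(\<Sum>t\<in>{t \<in> {1..sum_list \<mu>}. box_row \<mu> t = s}. h (box_row \<mu> t)) =
        (\<Sum>t\<in>{t \<in> {1..sum_list \<mu>}. box_row \<mu> t = s}. h s)"
      by (rule sum.cong) auto
    ultimately show "(\<Sum>t\<in>{t \<in> {1..sum_list \<mu>}. box_row \<mu> t = s}. h (box_row \<mu> t)) = \<mu> ! s * h s"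
      using card_box_row[of \<mu> s] by (simp only: sum_constant lessThan_iff if_True of_nat_id)
  qed
  finally show ?thesis .
qed

text \<open>A pair of words is a word of pairs, and it is fixed exactly when both components are.\<close>

lemma card_fixed_pairs:
  fixes U :: "('c \<Rightarrow> 'a) set" and V :: "('c \<Rightarrow> 'b) set"
  assumes "finite U" "finite V"
  shows "finite {w. fst \<circ> w \<in> U \<and> snd \<circ> w \<in> V}"
    and "card {w \<in> {w. fst \<circ> w \<in> U \<and> snd \<circ> w \<in> V}. w \<circ> g = w} =
      card {u \<in> U. u \<circ> g = u} * card {v \<in> V. v \<circ> g = v}"
proof -
  let ?pair = "\<lambda>(u, v) t. (u t, v t)"
  have pair: "?pair (fst \<circ> w, snd \<circ> w) = w" for w :: "'c \<Rightarrow> 'a \<times> 'b"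
    by simp
  have comps: "fst \<circ> ?pair (u, v) = u" "snd \<circ> ?pair (u, v) = v" for u :: "'c \<Rightarrow> 'a" and v :: "'c \<Rightarrow> 'b"
    by (simp_all add: o_def)
  have fixed: "w \<circ> g = w \<longleftrightarrow> (fst \<circ> w) \<circ> g = fst \<circ> w \<and> (snd \<circ> w) \<circ> g = snd \<circ> w"
    for w :: "'c \<Rightarrow> 'a \<times> 'b"
    by (auto simp: fun_eq_iff prod_eq_iff)
  have bij: "bij_betw (\<lambda>w. (fst \<circ> w, snd \<circ> w)) {w. fst \<circ> w \<in> U' \<and> snd \<circ> w \<in> V'} (U' \<times> V')"
    for U' :: "('c \<Rightarrow> 'a) set" and V' :: "('c \<Rightarrow> 'b) set"
    by (rule bij_betw_byWitness[where f' = ?pair]) (use pair comps in auto)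
  show "finite {w. fst \<circ> w \<in> U \<and> snd \<circ> w \<in> V}"
    using bij_betw_finite[OF bij[of U V]] assms by simp
  have "{w \<in> {w. fst \<circ> w \<in> U \<and> snd \<circ> w \<in> V}. w \<circ> g = w} =
      {w. fst \<circ> w \<in> {u \<in> U. u \<circ> g = u} \<and> snd \<circ> w \<in> {v \<in> V. v \<circ> g = v}}"
    unfolding fixed by blast
  then show "card {w \<in> {w. fst \<circ> w \<in> U \<and> snd \<circ> w \<in> V}. w \<circ> g = w} =
      card {u \<in> U. u \<circ> g = u} * card {v \<in> V. v \<circ> g = v}"
    using bij_betw_same_card[OF bij] by (simp only: card_cartesian_product)
qed

lemma card_fixed_conjugate:
  assumes closed: "\<And>w p. w \<in> X \<Longrightarrow> p permutes S \<Longrightarrow> w \<circ> p \<in> X" and x: "x permutes S"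
  shows "card {w \<in> X. w \<circ> (x \<circ> g \<circ> inv' x) = w} = card {w \<in> X. w \<circ> g = w}"
proof (rule bij_betw_same_card[where f = "\<lambda>w. w \<circ> x"], rule bij_betw_byWitness[where f' = "\<lambda>w. w \<circ> inv' x"])
  have iff: "w \<circ> (x \<circ> g \<circ> inv' x) = w \<longleftrightarrow> (w \<circ> x) \<circ> g = w \<circ> x" for w
    using comp_eq_comp_permutes[OF permutes_inv[OF x], of "w \<circ> x \<circ> g" w]
    by (simp add: comp_assoc permutes_inv_inv[OF x])
  show "(\<lambda>w. w \<circ> x) ` {w \<in> X. w \<circ> (x \<circ> g \<circ> inv' x) = w} \<subseteq> {w \<in> X. w \<circ> g = w}"
    using closed x unfolding iff by auto
  show "(\<lambda>w. w \<circ> inv' x) ` {w \<in> X. w \<circ> g = w} \<subseteq> {w \<in> X. w \<circ> (x \<circ> g \<circ> inv' x) = w}"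
    using closed permutes_inv[OF x] unfolding iff by (auto simp: comp_permutes_inv(4)[OF x])
qed (use comp_permutes_inv[OF x] in auto)

text \<open>The letters are the positions of the matrix, and \<open>\<sigma>\<close> lists the positions with nonzero entries in the
  order of the parts of \<open>\<gamma>\<close>. The word \<open>u0\<close> writes the letter \<open>\<sigma> ! i\<close> into row \<open>i\<close> of the
  tableau, so that column \<open>j\<close> carries exactly the positions with entry greater than \<open>j\<close>.
  Additivity says that those positions are strictly heavier than all others for the weight \<open>x i + y j\<close>, while the total weight of a word
  depends only on the margins. Hence \<open>column_rearrangement\<close> applies.\<close>

lemma additive_multiplicity_one:
  fixes \<alpha> \<beta> \<gamma> :: "nat list" and a :: "nat \<times> nat \<Rightarrow> nat" and \<sigma> :: "(nat \<times> nat) list" and x y :: "nat \<Rightarrow> real"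
  assumes rowsum: "\<And>i. i < length \<alpha> \<Longrightarrow> (\<Sum>j<length \<beta>. a (i, j)) = \<alpha> ! i"
    and colsum: "\<And>j. j < length \<beta> \<Longrightarrow> (\<Sum>i<length \<alpha>. a (i, j)) = \<beta> ! j"
    and \<sigma>: "distinct \<sigma>" "set \<sigma> \<subseteq> {..<length \<alpha>} \<times> {..<length \<beta>}" "map a \<sigma> = \<gamma>"
    and zero: "\<And>d. d \<in> {..<length \<alpha>} \<times> {..<length \<beta>} \<Longrightarrow> d \<notin> set \<sigma> \<Longrightarrow> a d = 0"
    and size: "sum_list \<alpha> = sum_list \<gamma>" "sum_list \<beta> = sum_list \<gamma>"
    and additive: "\<And>d e. d \<in> {..<length \<alpha>} \<times> {..<length \<beta>} \<Longrightarrow> e \<in> {..<length \<alpha>} \<times> {..<length \<beta>} \<Longrightarrow>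
      a d < a e \<Longrightarrow> x (fst d) + y (snd d) < x (fst e) + y (snd e)"
  shows "char_inner (sym_group (sum_list \<gamma>)) (char_tensor (perm_char \<alpha>) (perm_char \<beta>)) (irr_char \<gamma>) = 1"
proof -
  define n where "n = sum_list \<gamma>"
  define G where "G = sym_group n"
  define L where "L = {..<length \<alpha>} \<times> {..<length \<beta>}"
  define X where "X = {w. fst \<circ> w \<in> rearrangements n (box_row \<alpha>) \<and> snd \<circ> w \<in> rearrangements n (box_row \<beta>)}"
  \<comment> \<open>outside \<open>{1..n}\<close> the components of \<open>u0\<close> must agree with the two row words, like all rearrangements\<close>
  define u0 where "u0 t = (if t \<in> {1..n} then \<sigma> ! box_row \<gamma> t else (box_row \<alpha> t, box_row \<beta> t))" for t
  define c where "c = young_symmetrizer \<gamma>"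
  define k where "k = ga_mult G c c id"
  interpret group G unfolding G_def by (rule sym_group_is_group)
  have len: "length \<sigma> = length \<gamma>" using \<sigma>(3) by auto
  have a_nth: "a (\<sigma> ! i) = \<gamma> ! i" if "i < length \<gamma>" for i
    using nth_map[of i \<sigma> a] that unfolding len \<sigma>(3) by simp
  have row: "box_row \<gamma> t < length \<sigma>" if "t \<in> {1..n}" for t
    using canon_tableau_box(1)[of t \<gamma>] that len by (simp add: n_def)

  \<comment> \<open>the letter \<open>d\<close> occurs \<open>a d\<close> times in \<open>u0\<close>, which is why both components of \<open>u0\<close> are rearrangements\<close>
  have letters: "(\<Sum>t\<in>{1..n}. h (u0 t)) = (\<Sum>d\<in>L. a d * h d)" for h :: "nat \<times> nat \<Rightarrow> nat"
  proof -
    have "(\<Sum>t\<in>{1..n}. h (u0 t)) = (\<Sum>s<length \<gamma>. \<gamma> ! s * h (\<sigma> ! s))"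
      using sum_box_row[of "\<lambda>s. h (\<sigma> ! s)" \<gamma>] by (simp add: u0_def n_def)
    also have "\<dots> = (\<Sum>s<length \<sigma>. a (\<sigma> ! s) * h (\<sigma> ! s))"
      using a_nth by (simp add: len)
    also have "\<dots> = (\<Sum>d\<in>set \<sigma>. a d * h d)"
      by (rule sum.reindex_bij_betw[OF bij_betw_nth]) (use \<sigma>(1) in auto)
    also have "\<dots> = (\<Sum>d\<in>L. a d * h d)"
      using \<sigma>(2) zero by (intro sum.mono_neutral_left) (auto simp: L_def)
    finally show ?thesis .
  qed
  have fst_u0: "fst \<circ> u0 \<in> rearrangements n (box_row \<alpha>)"
  proof (rule rearrangementsI_card)
    fix i
    have "card {t \<in> {1..n}. (fst \<circ> u0) t = i} = (\<Sum>t\<in>{1..n}. if fst (u0 t) = i then 1 else 0)"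
      by (simp add: sum.If_cases Int_def)
    also have "\<dots> = (\<Sum>d\<in>L. a d * (if fst d = i then 1 else 0))"
      by (rule letters[of "\<lambda>d. if fst d = i then 1 else 0"])
    also have "\<dots> = (\<Sum>i'<length \<alpha>. \<Sum>j<length \<beta>. if i' = i then a (i, j) else 0)"
      unfolding L_def sum.cartesian_product by (rule sum.cong) auto
    also have "\<dots> = (\<Sum>i'<length \<alpha>. if i' = i then \<alpha> ! i else 0)"
      using rowsum by (intro sum.cong) auto
    also have "\<dots> = card {t \<in> {1..n}. box_row \<alpha> t = i}"
      using card_box_row[of \<alpha> i] size by (simp add: n_def)
    finally show "card {t \<in> {1..n}. (fst \<circ> u0) t = i} = card {t \<in> {1..n}. box_row \<alpha> t = i}" .
  qed (auto simp: u0_def)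
  have snd_u0: "snd \<circ> u0 \<in> rearrangements n (box_row \<beta>)"
  proof (rule rearrangementsI_card)
    fix j
    have "card {t \<in> {1..n}. (snd \<circ> u0) t = j} = (\<Sum>t\<in>{1..n}. if snd (u0 t) = j then 1 else 0)"
      by (simp add: sum.If_cases Int_def)
    also have "\<dots> = (\<Sum>d\<in>L. a d * (if snd d = j then 1 else 0))"
      by (rule letters[of "\<lambda>d. if snd d = j then 1 else 0"])
    also have "\<dots> = (\<Sum>i<length \<alpha>. \<Sum>j'<length \<beta>. if j' = j then a (i, j) else 0)"
      unfolding L_def sum.cartesian_product by (rule sum.cong) auto
    also have "\<dots> = (\<Sum>j'<length \<beta>. \<Sum>i<length \<alpha>. if j' = j then a (i, j) else 0)"
      by (rule sum.swap)
    also have "\<dots> = (\<Sum>j'<length \<beta>. if j' = j then \<beta> ! j else 0)"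
      using colsum by (intro sum.cong) auto
    also have "\<dots> = card {t \<in> {1..n}. box_row \<beta> t = j}"
      using card_box_row[of \<beta> j] size by (simp add: n_def)
    finally show "card {t \<in> {1..n}. (snd \<circ> u0) t = j} = card {t \<in> {1..n}. box_row \<beta> t = j}" .
  qed (auto simp: u0_def)
  have u0X: "u0 \<in> X" using fst_u0 snd_u0 by (simp add: X_def)
  have finX: "finite X"
    unfolding X_def by (intro card_fixed_pairs finite_rearrangements)
  have closed: "w \<circ> p \<in> X" if "w \<in> X" "p permutes {1..n}" for w p
    using that rearrangements_comp[of "fst \<circ> w" n "box_row \<alpha>" p] rearrangements_comp[of "snd \<circ> w" n "box_row \<beta>" p]
    by (simp add: X_def comp_assoc)

  have rows: "u0 \<circ> p = u0 \<circ> q \<longleftrightarrow> box_row \<gamma> \<circ> p = box_row \<gamma> \<circ> q"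
    if p: "p permutes {1..n}" and q: "q permutes {1..n}" for p q
  proof -
    have "u0 (p t) = u0 (q t) \<longleftrightarrow> box_row \<gamma> (p t) = box_row \<gamma> (q t)" for t
    proof (cases "t \<in> {1..n}")
      case True
      then have "p t \<in> {1..n}" "q t \<in> {1..n}"
        using p q by (simp_all only: permutes_in_image)
      then show ?thesis
        using row \<sigma>(1) unfolding u0_def by (simp only: if_True nth_eq_iff_index_eq)
    qed (use p q in \<open>simp add: permutes_not_in\<close>)
    then show ?thesis by (simp add: fun_eq_iff)
  qed

  have distinct: "\<exists>q\<in>column_subgroup \<gamma>. u = u0 \<circ> q"
    if u: "u \<in> X" and inj: "inj_on (\<lambda>t. (u t, box_col \<gamma> t)) {1..n}" for u
    unfolding column_subgroup_eq n_def[symmetric]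
  proof (rule column_rearrangement[where z = "\<lambda>d. x (fst d) + y (snd d)"])
    have u12: "fst \<circ> u \<in> rearrangements n (box_row \<alpha>)" "snd \<circ> u \<in> rearrangements n (box_row \<beta>)"
      using u by (simp_all add: X_def)
    show "inj_on (\<lambda>t. (u t, box_col \<gamma> t)) {1..n}" by (rule inj)
    show "inj_on (\<lambda>t. (u0 t, box_col \<gamma> t)) {1..n}"
    proof (rule inj_onI)
      fix s t assume st: "s \<in> {1..n}" "t \<in> {1..n}" "(u0 s, box_col \<gamma> s) = (u0 t, box_col \<gamma> t)"
      then have "box_row \<gamma> s = box_row \<gamma> t"
        using \<sigma>(1) row by (simp add: u0_def nth_eq_iff_index_eq)
      with st show "s = t"
        using box_inj[of \<gamma>] by (simp add: n_def inj_on_def)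
    qed
    show "u t = u0 t" if "t \<notin> {1..n}" for t
    proof -
      have "(fst \<circ> u) t = box_row \<alpha> t" "(snd \<circ> u) t = box_row \<beta> t"
        using rearrangements_outside[OF u12(1) that] rearrangements_outside[OF u12(2) that] .
      then show ?thesis unfolding u0_def if_not_P[OF that] by (simp add: prod_eq_iff)
    qed
    show "(\<Sum>t\<in>{1..n}. x (fst (u t)) + y (snd (u t))) = (\<Sum>t\<in>{1..n}. x (fst (u0 t)) + y (snd (u0 t)))"
      using rearrangements_sum[OF u12(1), of x] rearrangements_sum[OF u12(2), of y]
        rearrangements_sum[OF fst_u0, of x] rearrangements_sum[OF snd_u0, of y]
      by (simp add: sum.distrib)
    fix s t
    assume s: "s \<in> {1..n}" and t: "t \<in> {1..n}"
      and absent: "\<And>t'. t' \<in> {1..n} \<Longrightarrow> box_col \<gamma> t' = box_col \<gamma> s \<Longrightarrow> u0 t' \<noteq> u t"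
    have "(fst \<circ> u) t \<in> box_row \<alpha> ` {1..n}" "(snd \<circ> u) t \<in> box_row \<beta> ` {1..n}"
      using rearrangements_image[OF u12(1)] rearrangements_image[OF u12(2)] t by blast+
    then have "fst (u t) < length \<alpha>" "snd (u t) < length \<beta>"
      using canon_tableau_box(1)[of _ \<alpha>] canon_tableau_box(1)[of _ \<beta>] size by (auto simp: n_def)
    then have utL: "u t \<in> L" by (simp add: L_def mem_Times_iff)
    have u0s: "u0 s = \<sigma> ! box_row \<gamma> s" using s by (simp add: u0_def)
    have u0sL: "u0 s \<in> L" using \<sigma>(2) row[OF s] by (auto simp: u0s L_def dest: nth_mem)
    \<comment> \<open>an entry above \<open>box_col \<gamma> s\<close> would make \<open>u t\<close> a letter of \<open>u0\<close> in the column of \<open>s\<close>\<close>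
    have "a (u t) \<le> box_col \<gamma> s"
    proof (rule ccontr)
      assume big: "\<not> a (u t) \<le> box_col \<gamma> s"
      then have "u t \<in> set \<sigma>" using zero[of "u t"] utL by (auto simp: L_def)
      then obtain i where i: "i < length \<gamma>" "\<sigma> ! i = u t" by (auto simp: in_set_conv_nth len)
      with big have "box_col \<gamma> s < \<gamma> ! i" using a_nth[of i] by simp
      from box_canon_tableau[OF i(1) this] absent i(2) show False
        unfolding n_def[symmetric] by (metis u0_def)
    qed
    also have "box_col \<gamma> s < a (u0 s)"
      using canon_tableau_box(1,2)[of s \<gamma>] s a_nth by (simp add: n_def u0s[unfolded n_def])
    finally show "x (fst (u t)) + y (snd (u t)) < x (fst (u0 s)) + y (snd (u0 s))"
      using additive utL u0sL by (simp add: L_def)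
  qed

  have char: "char_tensor (perm_char \<alpha>) (perm_char \<beta>) g = of_nat (card {w \<in> X. w \<circ> g = w})"
    if "g permutes {1..n}" for g
    using that size unfolding X_def n_def card_fixed_pairs(2)[OF finite_rearrangements finite_rearrangements]
    by (simp add: char_tensor_def perm_char_eq_card_fixed)
  have k: "ga_mult G c c = fun_scale k c" "k \<noteq> 0" "k \<in> \<real>"
    using young_symmetrizer_quasi_idempotent[of \<gamma>] young_symmetrizer_scalar_nonzero[of \<gamma>]
      ga_mult_Reals[of c c id] young_symmetrizer_Reals[of \<gamma>]
    by (simp_all add: G_def n_def c_def k_def)
  have "char_inner G (char_tensor (perm_char \<alpha>) (perm_char \<beta>)) (irr_char \<gamma>) =
      (1 / k) * (\<Sum>g\<in>carrier G. char_tensor (perm_char \<alpha>) (perm_char \<beta>) g * c g)"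
    unfolding irr_char_def specht_module_def Let_def G_def[symmetric] n_def[symmetric] c_def[symmetric]
  proof (rule char_inner_left_ideal[OF _ k])
    show "finite (carrier G)" by (simp add: G_def finite_sym_group)
    show "c g \<in> \<real>" for g by (simp add: c_def young_symmetrizer_Reals)
    fix g assume "g \<in> carrier G"
    then have g: "g permutes {1..n}" by (simp add: G_def sym_group_carrier)
    show "char_tensor (perm_char \<alpha>) (perm_char \<beta>) (inv\<^bsub>G\<^esub> g) = char_tensor (perm_char \<alpha>) (perm_char \<beta>) g"
    proof -
      have "w \<circ> inv' g = w \<longleftrightarrow> w \<circ> g = w" for w :: "nat \<Rightarrow> nat \<times> nat"
        using comp_eq_comp_permutes[OF g, of w w] by auto
      then show ?thesis
        using g by (simp add: char permutes_inv G_def sym_group_carrier)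
    qed
    fix p assume "p \<in> carrier G"
    then have p: "p permutes {1..n}" by (simp add: G_def sym_group_carrier)
    show "char_tensor (perm_char \<alpha>) (perm_char \<beta>) (p \<otimes>\<^bsub>G\<^esub> g \<otimes>\<^bsub>G\<^esub> inv\<^bsub>G\<^esub> p) =
        char_tensor (perm_char \<alpha>) (perm_char \<beta>) g"
      using char[OF g] char[OF permutes_compose[OF permutes_inv[OF p] permutes_compose[OF g p]]]
        card_fixed_conjugate[OF closed p, of g] p
      by (simp add: G_def sym_group_carrier sym_group_mult)
  qed
  also have "(\<Sum>g\<in>carrier G. char_tensor (perm_char \<alpha>) (perm_char \<beta>) g * c g) =
      (\<Sum>g\<in>carrier G. of_nat (card {w \<in> X. w \<circ> g = w}) * c g)"
    using char by (intro sum.cong refl) (simp add: G_def sym_group_carrier)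
  also have "\<dots> = k"
    unfolding k_def G_def c_def n_def
    by (rule sum_fixed_words_young_symmetrizer)
      (use finX closed u0X rows distinct in \<open>simp_all add: n_def\<close>)
  finally show ?thesis
    using k(2) by (simp add: G_def n_def)
qed

text \<open>The positions sorted by decreasing entry, which turns the condition \<open>\<pi>(A) = \<gamma>\<close> into an explicit
  bijection between the nonzero entries and the parts of \<open>\<gamma>\<close>.\<close>

lemma pi_seq_enumeration:
  "\<exists>\<sigma>. distinct \<sigma> \<and> set \<sigma> = {d \<in> {..<dim_row A} \<times> {..<dim_col A}. A $$ d \<noteq> 0} \<and>
    map (\<lambda>d. A $$ d) \<sigma> = pi_seq A"
proof -
  define cs where "cs = filter (\<lambda>d. A $$ d \<noteq> 0) (List.product [0..<dim_row A] [0..<dim_col A])"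
  define \<sigma> where "\<sigma> = rev (sort_key (\<lambda>d. A $$ d) cs)"
  have "entry_list A = map (\<lambda>d. A $$ d) (List.product [0..<dim_row A] [0..<dim_col A])"
    by (simp add: entry_list_def product_concat_map map_concat o_def)
  then have "filter (\<lambda>a. a \<noteq> 0) (entry_list A) = map (\<lambda>d. A $$ d) cs"
    by (simp add: cs_def filter_map o_def)
  moreover have "sort (map (\<lambda>d. A $$ d) cs) = map (\<lambda>d. A $$ d) (sort_key (\<lambda>d. A $$ d) cs)"
    by (rule properties_for_sort) simp_all
  ultimately have "map (\<lambda>d. A $$ d) \<sigma> = pi_seq A"
    by (simp add: pi_seq_def \<sigma>_def rev_map)
  moreover have "distinct \<sigma>"
    by (simp add: \<sigma>_def cs_def distinct_product)
  moreover have "set \<sigma> = {d \<in> {..<dim_row A} \<times> {..<dim_col A}. A $$ d \<noteq> 0}"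
    by (auto simp: \<sigma>_def cs_def)
  ultimately show ?thesis by blast
qed

theorem theorem6p1:
  fixes \<alpha> \<beta> \<gamma> :: "nat list" and A :: "nat mat"
  assumes "is_partition \<alpha>" and "is_partition \<beta>" and "is_partition \<gamma>"
    and "sum_list \<alpha> = sum_list \<gamma>" and "sum_list \<beta> = sum_list \<gamma>"
    and "A \<in> margin_matrices_pi \<alpha> \<beta> \<gamma>"
    and "additive_matrix A"
  shows "\<forall>n::nat. n > 0 \<longrightarrow>
    char_inner (sym_group (sum_list (scale_partition n \<gamma>)))
      (char_tensor (perm_char (scale_partition n \<alpha>)) (perm_char (scale_partition n \<beta>)))
      (irr_char (scale_partition n \<gamma>)) = 1"
proof (intro allI impI)
  fix n :: nat assume n: "n > 0"
  have A: "dim_row A = length \<alpha>" "dim_col A = length \<beta>" "pi_seq A = \<gamma>"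
    "\<And>i. i < length \<alpha> \<Longrightarrow> (\<Sum>j<length \<beta>. A $$ (i, j)) = \<alpha> ! i"
    "\<And>j. j < length \<beta> \<Longrightarrow> (\<Sum>i<length \<alpha>. A $$ (i, j)) = \<beta> ! j"
    using assms(6) by (auto simp: margin_matrices_pi_def margin_matrices_def)
  obtain x y :: "nat \<Rightarrow> real" where xy: "\<And>i k j l. i < length \<alpha> \<Longrightarrow> k < length \<alpha> \<Longrightarrow>
      j < length \<beta> \<Longrightarrow> l < length \<beta> \<Longrightarrow> A $$ (i, j) > A $$ (k, l) \<Longrightarrow> x i + y j > x k + y l"
    using assms(7) unfolding additive_matrix_def A by metis
  obtain \<sigma> where \<sigma>: "distinct \<sigma>" "set \<sigma> = {d \<in> {..<length \<alpha>} \<times> {..<length \<beta>}. A $$ d \<noteq> 0}"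
    "map (\<lambda>d. A $$ d) \<sigma> = \<gamma>"
    using pi_seq_enumeration[of A] unfolding A by blast
  have scale: "sum_list (scale_partition n \<mu>) = n * sum_list \<mu>" for \<mu>
    by (simp add: scale_partition_def sum_list_const_mult)
  show "char_inner (sym_group (sum_list (scale_partition n \<gamma>)))
      (char_tensor (perm_char (scale_partition n \<alpha>)) (perm_char (scale_partition n \<beta>)))
      (irr_char (scale_partition n \<gamma>)) = 1"
  \<comment> \<open>additivity of \<open>A\<close> passes to \<open>n A\<close> with the same \<open>x\<close> and \<open>y\<close>\<close>
  proof (rule additive_multiplicity_one[where a = "\<lambda>d. n * A $$ d" and \<sigma> = \<sigma> and x = x and y = y])
    show "map (\<lambda>d. n * A $$ d) \<sigma> = scale_partition n \<gamma>"
      by (simp add: scale_partition_def o_def flip: \<sigma>(3))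
    show "sum_list (scale_partition n \<alpha>) = sum_list (scale_partition n \<gamma>)"
      "sum_list (scale_partition n \<beta>) = sum_list (scale_partition n \<gamma>)"
      using assms(4,5) by (simp_all add: scale)
    show "(\<Sum>j<length (scale_partition n \<beta>). n * A $$ (i, j)) = scale_partition n \<alpha> ! i"
      if "i < length (scale_partition n \<alpha>)" for i
      using A(4) that by (simp add: scale_partition_def flip: sum_distrib_left)
    show "(\<Sum>i<length (scale_partition n \<alpha>). n * A $$ (i, j)) = scale_partition n \<beta> ! j"
      if "j < length (scale_partition n \<beta>)" for j
      using A(5) that by (simp add: scale_partition_def flip: sum_distrib_left)
    show "set \<sigma> \<subseteq> {..<length (scale_partition n \<alpha>)} \<times> {..<length (scale_partition n \<beta>)}"
      unfolding \<sigma>(2) by (auto simp: scale_partition_def)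
    show "n * A $$ d = 0"
      if "d \<in> {..<length (scale_partition n \<alpha>)} \<times> {..<length (scale_partition n \<beta>)}" "d \<notin> set \<sigma>" for d
      using that unfolding \<sigma>(2) by (auto simp: scale_partition_def)
    show "x (fst d) + y (snd d) < x (fst e) + y (snd e)"
      if "d \<in> {..<length (scale_partition n \<alpha>)} \<times> {..<length (scale_partition n \<beta>)}"
        "e \<in> {..<length (scale_partition n \<alpha>)} \<times> {..<length (scale_partition n \<beta>)}"
        "n * A $$ d < n * A $$ e" for d e
      using xy[of "fst e" "fst d" "snd e" "snd d"] that
      by (simp add: scale_partition_def mem_Times_iff)
  qed (rule \<sigma>(1))
qed

end
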